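(* Let $k$ be an algebraically closed field of characteristic $0$ and let $v$ be a rank-one discrete valuation of $K_n=k((X_1,\ldots,X_n))$ over $k$, with value group $\mathbb{Z}$, whose center in $k[[X_1,\ldots,X_n]]$ is the maximal ideal $(X_1,\ldots,X_n)$. Then an element of value $1$ can be constructed by applying a finite number of monoidal transformations and changes of coordinates: there is a finite sequence of monoidal transformations and changes of coordinates, starting from $X_1,\ldots,X_n$, such that one of the resulting elements $Y_1,\ldots,Y_n\in\widehat{R}_v$ satisfies $\widehat v(Y_i)=1$.
   Context: $k((X_1,\ldots,X_n))$ is the quotient field of $k[[X_1,\ldots,X_n]]$. $\widehat{K}_n$ is the completion of $K_n$ with respect to $v$, $\widehat v$ is the extension of $v$ to $\widehat K_n$, and $\widehat R_v$, $\widehat{\mathfrak m}_v$ are the valuation ring of $\widehat v$ and its maximal ideal. Transformations: at each stage one has a coefficient field $F$ with $k\subseteq F\subset\widehat R_v$ (initially $F=k$) and $n$ current variables $X_1,\ldots,X_n$, which are elements of $\widehat R_v$ (initially the given variables). (1) Monoidal transformation, allowed when $\widehat v(X_2)>\widehat v(X_1)$: the homomorphism $F[[X_1,\ldots,X_n]]\to F[[Y_1,\ldots,Y_n]]$, $X_1\mapsto Y_1$, $X_2\mapsto Y_1Y_2$, $X_i\mapsto Y_i$ for $i\ge 3$; the new elements of $\widehat R_v$ are $Y_2=X_2/X_1$ and $Y_i=X_i$ for $i\neq2$. (2) Change of coordinates: the homomorphism $F[[X_1,\ldots,X_n]]\to L[[Y_1,\ldots,Y_n]]$, $X_1\mapsto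 Y_1$, $X_i\mapsto Y_i+c_iY_1$ for $i\ge2$, where $L\supseteq F$ is an extension field, $L\subset\widehat R_v$, and $c_i\in L$ with $c_i\in\widehat R_v\setminus\widehat{\mathfrak m}_v$; the new elements are $Y_1=X_1$ and $Y_i=X_i-c_iY_1$ for $i\ge2$. Interchanges of variables are also allowed, so indices $1,2$ may be replaced by any pair of distinct indices. *)

theory Defs
  imports
    "HOL-Computational_Algebra.Computational_Algebra"
    "HOL-Library.Extended"
    "HOL-Library.Function_Algebras"
    "HOL-Library.FuncSet"
begin

section \<open>Formal power series in finitely many variables\<close>

text \<open>
  The variables are indexed by a finite type \<open>'n\<close>, so \<open>n\<close> is the cardinality of \<open>'n\<close>.
  An exponent vector is a function \<open>'n \<Rightarrow> nat\<close>; exponent vectors are added pointwise.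
\<close>

typedef ('a, 'n) mfps = "UNIV :: (('n \<Rightarrow> nat) \<Rightarrow> 'a) set"
  morphisms mfps_coeff Abs_mfps ..

lemma mfps_coeff_Abs [simp]: "mfps_coeff (Abs_mfps f) = f"
  by (simp add: Abs_mfps_inverse)

lemma mfps_eqI: "(\<And>a. mfps_coeff f a = mfps_coeff g a) \<Longrightarrow> f = g"
  by (metis ext mfps_coeff_inject)

lemma mfps_eq_iff: "f = g \<longleftrightarrow> (\<forall>a. mfps_coeff f a = mfps_coeff g a)"
  using mfps_eqI by blast

lemma finite_exponents_le: "finite {b :: 'n::finite \<Rightarrow> nat. b \<le> a}"
proof -
  have "{b. b \<le> a} \<subseteq> {b. b \<in> UNIV \<rightarrow> {.. Max (range a)}}"
    by (auto simp: le_fun_def) (meson Max_ge UNIV_I finite finite_imageI image_eqI order_trans)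
  moreover have "finite {b :: 'n \<Rightarrow> nat. b \<in> UNIV \<rightarrow> {.. Max (range a)}}"
    using finite_PiE[of "UNIV :: 'n set" "\<lambda>_. {.. Max (range a)}"]
    by (simp add: PiE_def extensional_def)
  ultimately show ?thesis
    using finite_subset by blast
qed

definition splits :: "('n \<Rightarrow> nat) \<Rightarrow> (('n \<Rightarrow> nat) \<times> ('n \<Rightarrow> nat)) set" where
  "splits a = {(b, c). b + c = a}"

lemma finite_splits [simp]: "finite (splits (a :: 'n::finite \<Rightarrow> nat))"
  by (rule finite_subset[of _ "{b. b \<le> a} \<times> {b. b \<le> a}"])
     (use finite_exponents_le[of a] in \<open>auto simp: splits_def le_fun_def\<close>)

instantiation mfps :: (comm_ring_1, finite) comm_ring_1
begin

definition zero_mfps :: "('a, 'b) mfps" where "0 = Abs_mfps (\<lambda>_. 0)"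
definition one_mfps :: "('a, 'b) mfps" where "1 = Abs_mfps (\<lambda>a. if a = 0 then 1 else 0)"
definition plus_mfps :: "('a, 'b) mfps \<Rightarrow> ('a, 'b) mfps \<Rightarrow> ('a, 'b) mfps" where
  "f + g = Abs_mfps (\<lambda>a. mfps_coeff f a + mfps_coeff g a)"
definition minus_mfps :: "('a, 'b) mfps \<Rightarrow> ('a, 'b) mfps \<Rightarrow> ('a, 'b) mfps" where
  "f - g = Abs_mfps (\<lambda>a. mfps_coeff f a - mfps_coeff g a)"
definition uminus_mfps :: "('a, 'b) mfps \<Rightarrow> ('a, 'b) mfps" where
  "- f = Abs_mfps (\<lambda>a. - mfps_coeff f a)"
definition times_mfps :: "('a, 'b) mfps \<Rightarrow> ('a, 'b) mfps \<Rightarrow> ('a, 'b) mfps" where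
  "f * g = Abs_mfps (\<lambda>a. \<Sum>(b, c)\<in>splits a. mfps_coeff f b * mfps_coeff g c)"

instance
proof
  fix f g h :: "('a, 'b) mfps"
  note defs = zero_mfps_def one_mfps_def plus_mfps_def minus_mfps_def uminus_mfps_def
    times_mfps_def
  show "f + g + h = f + (g + h)" "f + g = g + f" "0 + f = f" "- f + f = 0" "f - g = f + - g"
    by (simp_all add: defs mfps_eq_iff algebra_simps)
  show "(0 :: ('a, 'b) mfps) \<noteq> 1"
    by (auto simp: defs mfps_eq_iff)
  show "f * g = g * f"
  proof (rule mfps_eqI)
    fix a
    show "mfps_coeff (f * g) a = mfps_coeff (g * f) a"
      unfolding defs mfps_coeff_Abs
      by (rule sum.reindex_bij_witness[of _ prod.swap prod.swap])
         (auto simp: splits_def algebra_simps)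
  qed
  show "1 * f = f"
  proof (rule mfps_eqI)
    fix a
    have "mfps_coeff (1 * f) a
        = (\<Sum>p\<in>splits a. if p = (0, a) then mfps_coeff f a else 0)"
      unfolding defs mfps_coeff_Abs
      by (rule sum.cong) (auto simp: splits_def split: if_splits)
    also have "\<dots> = mfps_coeff f a"
      by (subst sum.delta[OF finite_splits]) (simp add: splits_def)
    finally show "mfps_coeff (1 * f) a = mfps_coeff f a" .
  qed
  show "(f + g) * h = f * h + g * h"
    by (simp add: defs mfps_eq_iff algebra_simps sum.distrib case_prod_unfold)
  show "f * g * h = f * (g * h)"
  proof (rule mfps_eqI)
    fix a
    have "mfps_coeff (f * g * h) a
        = (\<Sum>((b, c), d, e)\<in>Sigma (splits a) (\<lambda>(b, c). splits b).
            mfps_coeff f d * mfps_coeff g e * mfps_coeff h c)"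
      by (simp add: defs sum.Sigma sum_distrib_right case_prod_unfold)
    also have "\<dots> = (\<Sum>((b, c), d, e)\<in>Sigma (splits a) (\<lambda>(b, c). splits c).
            mfps_coeff f b * mfps_coeff g d * mfps_coeff h e)"
      by (rule sum.reindex_bij_witness
            [of _ "\<lambda>((b, c), d, e). ((b + d, e), b, d)" "\<lambda>((b, c), d, e). ((d, e + c), e, c)"])
         (auto simp: splits_def add.assoc)
    also have "\<dots> = mfps_coeff (f * (g * h)) a"
      by (simp add: defs sum.Sigma sum_distrib_left case_prod_unfold mult.assoc)
    finally show "mfps_coeff (f * g * h) a = mfps_coeff (f * (g * h)) a" .
  qed
qed

end

lemma mfps_coeff_zero [simp]: "mfps_coeff 0 a = 0"
  by (simp add: zero_mfps_def)

lemma mfps_coeff_one: "mfps_coeff 1 a = (if a = 0 then 1 else 0)"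
  by (simp add: one_mfps_def)

lemma mfps_coeff_add [simp]: "mfps_coeff (f + g) a = mfps_coeff f a + mfps_coeff g a"
  by (simp add: plus_mfps_def)

lemma mfps_coeff_mult:
  "mfps_coeff (f * g) a = (\<Sum>(b, c)\<in>splits a. mfps_coeff f b * mfps_coeff g c)"
  by (simp add: times_mfps_def)

lemma exponent_weight:
  obtains h :: "('n::finite \<Rightarrow> nat) \<Rightarrow> nat"
  where "inj h" "\<And>a b. h (a + b) = h a * h b" "\<And>a. h a > 0"
proof -
  obtain q :: "nat \<Rightarrow> nat" where q: "inj q" "range q \<subseteq> {p. prime p}"
    using infinite_countable_subset[OF primes_infinite] by blast
  obtain t :: "'n \<Rightarrow> nat" where t: "inj t"
    using finite_imp_inj_to_nat_seg[of "UNIV :: 'n set"] by auto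
  define p where "p = q \<circ> t"
  have p: "inj p" "prime (p i)" for i
    using q t by (auto simp: p_def inj_compose)
  have mult: "multiplicity (p j) (\<Prod>i\<in>UNIV. p i ^ a i) = a j" for a j
  proof -
    have "(\<Prod>i\<in>UNIV. p i ^ a i) = (\<Prod>x\<in>range p. x ^ a (inv p x))"
      by (subst prod.reindex) (use p in auto)
    thus ?thesis
      using multiplicity_prod_prime_powers[of "range p" "p j" "\<lambda>x. a (inv p x)"] p by auto
  qed
  show thesis
  proof (rule that[of "\<lambda>a. \<Prod>i\<in>UNIV. p i ^ a i"])
    show "inj (\<lambda>a. \<Prod>i\<in>UNIV. p i ^ a i)"
      by (intro injI ext) (metis mult)
  qed (use p prime_gt_0_nat in \<open>auto simp: power_add prod.distrib intro!: prod_pos\<close>)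
qed

instance mfps :: (idom, finite) idom
proof
  fix f g :: "('a, 'b) mfps"
  assume fg: "f \<noteq> 0" "g \<noteq> 0"
  obtain h :: "('b \<Rightarrow> nat) \<Rightarrow> nat" where h:
    "inj h" "\<And>a b. h (a + b) = h a * h b" "\<And>a. h a > 0"
    using exponent_weight by blast
  have least: "\<exists>a. mfps_coeff u a \<noteq> 0 \<and> (\<forall>b. mfps_coeff u b \<noteq> 0 \<longrightarrow> h a \<le> h b)"
    if "u \<noteq> 0" for u :: "('a, 'b) mfps"
  proof -
    from that obtain a where "mfps_coeff u a \<noteq> 0"
      by (auto simp: mfps_eq_iff)
    thus ?thesis
      using ex_has_least_nat[of "\<lambda>a. mfps_coeff u a \<noteq> 0" a h] by blast
  qed
  obtain a where a: "mfps_coeff f a \<noteq> 0" "\<And>b. mfps_coeff f b \<noteq> 0 \<Longrightarrow> h a \<le> h b"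
    using least[OF fg(1)] by blast
  obtain c where c: "mfps_coeff g c \<noteq> 0" "\<And>b. mfps_coeff g b \<noteq> 0 \<Longrightarrow> h c \<le> h b"
    using least[OF fg(2)] by blast
  have "mfps_coeff (f * g) (a + c)
      = (\<Sum>p\<in>splits (a + c). if p = (a, c) then mfps_coeff f a * mfps_coeff g c else 0)"
    unfolding mfps_coeff_mult
  proof (rule sum.cong, rule refl, clarify)
    fix b d assume "(b, d) \<in> splits (a + c)"
    hence eq: "h b * h d = h a * h c"
      by (metis (mono_tags, lifting) case_prodD h(2) mem_Collect_eq splits_def)
    have "b = a \<and> d = c" if "mfps_coeff f b \<noteq> 0" "mfps_coeff g d \<noteq> 0"
    proof -
      have le: "h a \<le> h b" "h c \<le> h d"
        using a c that by auto
      have "h a = h b"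
      proof (rule ccontr)
        assume "h a \<noteq> h b"
        with le have "h a * h c < h b * h d"
          using h(3) by (intro mult_less_le_imp_less) auto
        with eq show False by simp
      qed
      moreover from this have "h c = h d"
        using eq h(3)[of a] by simp
      ultimately show ?thesis
        using h(1) by (auto dest: injD)
    qed
    thus "mfps_coeff f b * mfps_coeff g d
        = (if (b, d) = (a, c) then mfps_coeff f a * mfps_coeff g c else 0)"
      by auto
  qed
  also have "\<dots> = mfps_coeff f a * mfps_coeff g c"
    by (subst sum.delta[OF finite_splits]) (simp add: splits_def)
  finally have "mfps_coeff (f * g) (a + c) \<noteq> 0"
    using a(1) c(1) by simp
  thus "f * g \<noteq> 0"
    by (metis mfps_coeff_zero)
qed

definition mfps_const :: "'a::zero \<Rightarrow> ('a, 'n::finite) mfps" where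
  "mfps_const c = Abs_mfps (\<lambda>a. if a = 0 then c else 0)"

definition mfps_X :: "'n::finite \<Rightarrow> ('a::zero_neq_one, 'n) mfps" where
  "mfps_X i = Abs_mfps (\<lambda>a. if a = (\<lambda>j. if j = i then 1 else 0) then 1 else 0)"

definition mfps_over :: "'a set \<Rightarrow> ('a, 'n) mfps set" where
  "mfps_over F = {f. \<forall>a. mfps_coeff f a \<in> F}"

definition total_degree :: "('n::finite \<Rightarrow> nat) \<Rightarrow> nat" where
  "total_degree a = (\<Sum>i\<in>UNIV. a i)"

text \<open>
  Substitution \<open>X\<^sub>i \<mapsto> g i\<close>, meaningful when every \<open>g i\<close> has constant coefficient \<open>0\<close>: then
  \<open>\<Prod>\<^sub>i g\<^sub>i ^ a\<^sub>i\<close> has no terms of total degree less than that of \<open>a\<close>, so the truncated sum below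
  is the full coefficient of \<open>\<Sum>\<^sub>a f\<^sub>a \<Prod>\<^sub>i g\<^sub>i ^ a\<^sub>i\<close>.
\<close>

definition mfps_subst ::
    "('n \<Rightarrow> ('a::comm_ring_1, 'n::finite) mfps) \<Rightarrow> ('a, 'n) mfps \<Rightarrow> ('a, 'n) mfps" where
  "mfps_subst g f = Abs_mfps (\<lambda>b. \<Sum>a | total_degree a \<le> total_degree b.
     mfps_coeff f a * mfps_coeff (\<Prod>i\<in>UNIV. g i ^ a i) b)"

lemma total_degree_add [simp]: "total_degree (a + b) = total_degree a + total_degree b"
  by (simp add: total_degree_def sum.distrib)

lemma finite_total_degree_le [simp]: "finite {a :: 'n::finite \<Rightarrow> nat. total_degree a \<le> d}"
proof (rule finite_subset)
  show "{a :: 'n \<Rightarrow> nat. total_degree a \<le> d} \<subseteq> {a. a \<le> (\<lambda>_. d)}"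
  proof (clarify, rule le_funI)
    fix a :: "'n \<Rightarrow> nat" and i
    assume "total_degree a \<le> d"
    thus "a i \<le> d"
      using member_le_sum[of i UNIV a] by (simp add: total_degree_def)
  qed
qed (rule finite_exponents_le)

lemma low_coeffs_mult:
  assumes "\<And>b. total_degree b < m \<Longrightarrow> mfps_coeff f b = 0"
    and "\<And>b. total_degree b < n \<Longrightarrow> mfps_coeff g b = 0"
    and "total_degree b < m + n"
  shows "mfps_coeff (f * g) b = 0"
  unfolding mfps_coeff_mult
proof (rule sum.neutral, clarify)
  fix c d assume "(c, d) \<in> splits b"
  hence "total_degree c + total_degree d < m + n"
    using assms(3) by (auto simp: splits_def)
  hence "total_degree c < m \<or> total_degree d < n"
    by linarith
  thus "mfps_coeff f c * mfps_coeff g d = 0"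
    using assms(1,2) by auto
qed

lemma total_degree_eq_0_iff [simp]: "total_degree a = 0 \<longleftrightarrow> a = 0"
  by (auto simp: total_degree_def fun_eq_iff)

lemma low_coeffs_power:
  assumes "mfps_coeff g 0 = 0" "total_degree b < n"
  shows "mfps_coeff (g ^ n) b = 0"
  using assms(2)
proof (induction n arbitrary: b)
  case (Suc n)
  show ?case
    unfolding power_Suc
  proof (rule low_coeffs_mult[of 1 g n])
    show "mfps_coeff g b = 0" if "total_degree b < 1" for b
      using that assms(1) by simp
  qed (use Suc in auto)
qed simp

lemma low_coeffs_monomial:
  fixes g :: "'n \<Rightarrow> ('a::comm_ring_1, 'n::finite) mfps"
  assumes "\<And>i. mfps_coeff (g i) 0 = 0" "total_degree b < total_degree a"
  shows "mfps_coeff (\<Prod>i\<in>UNIV. g i ^ a i) b = 0"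
proof -
  have "mfps_coeff (\<Prod>i\<in>A. g i ^ a i) b = 0" if "finite A" "total_degree b < sum a A" for A b
    using that
  proof (induction A arbitrary: b rule: finite_induct)
    case (insert x A)
    show ?case
      unfolding prod.insert[OF insert(1,2)]
      by (rule low_coeffs_mult[of "a x" _ "sum a A"])
         (use insert assms(1) in \<open>auto intro: low_coeffs_power\<close>)
  qed simp
  from this[of UNIV] assms(2) show ?thesis
    by (simp add: total_degree_def)
qed

lemma mfps_subst_add: "mfps_subst g (f + h) = mfps_subst g f + mfps_subst g h"
  by (rule mfps_eqI) (simp add: mfps_subst_def algebra_simps sum.distrib)

lemma mfps_subst_const:
  fixes g :: "'n \<Rightarrow> ('a::comm_ring_1, 'n::finite) mfps"
  shows "mfps_subst g (mfps_const c) = mfps_const c"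
proof (rule mfps_eqI)
  fix b :: "'n \<Rightarrow> nat"
  have "mfps_coeff (mfps_subst g (mfps_const c)) b
      = (\<Sum>a :: 'n \<Rightarrow> nat | total_degree a \<le> total_degree b.
          if a = 0 then c * mfps_coeff (1 :: ('a, 'n) mfps) b else 0)"
    unfolding mfps_subst_def mfps_const_def mfps_coeff_Abs
    by (rule sum.cong[OF refl]) simp
  also have "\<dots> = mfps_coeff (mfps_const c) b"
    by (subst sum.delta[OF finite_total_degree_le]) (simp add: mfps_const_def mfps_coeff_one)
  finally show "mfps_coeff (mfps_subst g (mfps_const c)) b = mfps_coeff (mfps_const c) b" .
qed

lemma mfps_subst_X:
  fixes g :: "'n \<Rightarrow> ('a::comm_ring_1, 'n::finite) mfps"
  assumes "\<And>i. mfps_coeff (g i) 0 = 0"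
  shows "mfps_subst g (mfps_X i) = g i"
proof (rule mfps_eqI)
  fix b :: "'n \<Rightarrow> nat"
  define e :: "'n \<Rightarrow> nat" where "e = (\<lambda>j. if j = i then 1 else 0)"
  have "(\<Prod>j\<in>UNIV. g j ^ e j) = (\<Prod>j\<in>UNIV. if j = i then g j else 1)"
    by (rule prod.cong) (auto simp: e_def)
  hence e: "(\<Prod>j\<in>UNIV. g j ^ e j) = g i" "total_degree e = 1"
    by (auto simp: e_def total_degree_def)
  have "mfps_coeff (mfps_subst g (mfps_X i)) b
      = (\<Sum>a | total_degree a \<le> total_degree b. if a = e then mfps_coeff (g i) b else 0)"
    unfolding mfps_subst_def mfps_X_def mfps_coeff_Abs e_def[symmetric]
    by (rule sum.cong) (auto simp: e)
  also have "\<dots> = mfps_coeff (g i) b"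
  proof (cases "b = 0")
    case True
    thus ?thesis using assms[of i] by (auto intro!: sum.neutral)
  next
    case False
    hence "total_degree b \<noteq> 0" by simp
    hence "total_degree e \<le> total_degree b" using e(2) by linarith
    thus ?thesis by (subst sum.delta) auto
  qed
  finally show "mfps_coeff (mfps_subst g (mfps_X i)) b = mfps_coeff (g i) b" .
qed

lemma mfps_subst_mult:
  fixes g :: "'n \<Rightarrow> ('a::comm_ring_1, 'n::finite) mfps"
  assumes g: "\<And>i. mfps_coeff (g i) 0 = 0"
  shows "mfps_subst g (f * h) = mfps_subst g f * mfps_subst g h"
proof (rule mfps_eqI)
  fix b :: "'n \<Rightarrow> nat"
  define M where "M a = (\<Prod>i\<in>UNIV. g i ^ a i)" for a :: "'n \<Rightarrow> nat"
  define D where "D = {a :: 'n \<Rightarrow> nat. total_degree a \<le> total_degree b}"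
  have fin [simp]: "finite D" by (simp add: D_def)
  have M_add: "M (a + c) = M a * M c" for a c
    by (simp add: M_def power_add prod.distrib)
  have M_low: "mfps_coeff (M a) c = 0" if "total_degree c < total_degree a" for a c
    unfolding M_def using low_coeffs_monomial[OF g that] .
  have ext: "mfps_coeff (mfps_subst g u) c = (\<Sum>a\<in>D. mfps_coeff u a * mfps_coeff (M a) c)"
    if "total_degree c \<le> total_degree b" for u c
    unfolding mfps_subst_def mfps_coeff_Abs M_def[symmetric]
    by (rule sum.mono_neutral_left)
       (use that in \<open>auto simp: D_def not_le M_low\<close>)
  have "mfps_coeff (mfps_subst g f * mfps_subst g h) b
      = (\<Sum>(p, q)\<in>splits b. (\<Sum>a\<in>D. mfps_coeff f a * mfps_coeff (M a) p)
          * (\<Sum>c\<in>D. mfps_coeff h c * mfps_coeff (M c) q))"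
    unfolding mfps_coeff_mult
    by (rule sum.cong) (auto simp: splits_def ext)
  also have "\<dots> = (\<Sum>(p, q)\<in>splits b. \<Sum>(a, c)\<in>D \<times> D.
      mfps_coeff f a * mfps_coeff h c * (mfps_coeff (M a) p * mfps_coeff (M c) q))"
    by (simp add: sum_product sum.cartesian_product case_prod_unfold mult_ac)
  also have "\<dots> = (\<Sum>(a, c)\<in>D \<times> D. mfps_coeff f a * mfps_coeff h c * mfps_coeff (M (a + c)) b)"
    unfolding M_add mfps_coeff_mult case_prod_unfold
    by (subst sum.swap) (simp add: sum_distrib_left)
  also have "\<dots> = (\<Sum>(a, c)\<in>{(a, c). a + c \<in> D}.
      mfps_coeff f a * mfps_coeff h c * mfps_coeff (M (a + c)) b)"
  proof (rule sum.mono_neutral_right)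
    show "\<forall>p\<in>D \<times> D - {(a, c). a + c \<in> D}.
        (case p of (a, c) \<Rightarrow> mfps_coeff f a * mfps_coeff h c * mfps_coeff (M (a + c)) b) = 0"
    proof
      fix p assume "p \<in> D \<times> D - {(a, c). a + c \<in> D}"
      then obtain a c where p: "p = (a, c)" "a + c \<notin> D"
        by auto
      hence "mfps_coeff (M (a + c)) b = 0"
        by (intro M_low) (simp add: D_def)
      thus "(case p of (a, c) \<Rightarrow> mfps_coeff f a * mfps_coeff h c * mfps_coeff (M (a + c)) b) = 0"
        by (simp add: p)
    qed
  qed (auto simp: D_def)
  also have "\<dots> = (\<Sum>(d, a, c)\<in>Sigma D splits.
      mfps_coeff f a * mfps_coeff h c * mfps_coeff (M d) b)"
    by (rule sum.reindex_bij_witness[of _ snd "\<lambda>(a, c). (a + c, a, c)"])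
       (auto simp: splits_def)
  also have "\<dots> = (\<Sum>d\<in>D. mfps_coeff (f * h) d * mfps_coeff (M d) b)"
    by (subst sum.Sigma[symmetric])
       (auto simp: mfps_coeff_mult sum_distrib_right case_prod_unfold)
  also have "\<dots> = mfps_coeff (mfps_subst g (f * h)) b"
    by (simp add: ext)
  finally show "mfps_coeff (mfps_subst g (f * h)) b
      = mfps_coeff (mfps_subst g f * mfps_subst g h) b" ..
qed

section \<open>Discrete valuations and completions\<close>

text \<open>
  Valuations are normalised (value group \<open>\<int>\<close>) and extended by \<open>v 0 = \<infinity>\<close>; the value
  \<open>-\<infinity>\<close> of the type \<^typ>\<open>int extended\<close> is never taken.
\<close>

definition discrete_valuation :: "('a::field \<Rightarrow> int extended) \<Rightarrow> bool" where
  "discrete_valuation v \<longleftrightarrow>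
     v 0 = \<infinity> \<and>
     v ` (- {0}) = range Fin \<and>
     (\<forall>x y. v (x * y) = v x + v y) \<and>
     (\<forall>x y. min (v x) (v y) \<le> v (x + y))"

definition valuation_ring :: "('a \<Rightarrow> int extended) \<Rightarrow> 'a set" where
  "valuation_ring v = {x. Fin 0 \<le> v x}"

definition valuation_ideal :: "('a \<Rightarrow> int extended) \<Rightarrow> 'a set" where
  "valuation_ideal v = {x. Fin 0 < v x}"

definition field_embedding :: "('a::field \<Rightarrow> 'b::field) \<Rightarrow> bool" where
  "field_embedding \<iota> \<longleftrightarrow>
     \<iota> 1 = 1 \<and> (\<forall>x y. \<iota> (x + y) = \<iota> x + \<iota> y) \<and> (\<forall>x y. \<iota> (x * y) = \<iota> x * \<iota> y)"

definition val_Cauchy :: "('a::field \<Rightarrow> int extended) \<Rightarrow> (nat \<Rightarrow> 'a) \<Rightarrow> bool" where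
  "val_Cauchy v s \<longleftrightarrow> (\<forall>N. \<exists>M. \<forall>m\<ge>M. \<forall>n\<ge>M. Fin N \<le> v (s m - s n))"

definition val_tendsto :: "('a::field \<Rightarrow> int extended) \<Rightarrow> (nat \<Rightarrow> 'a) \<Rightarrow> 'a \<Rightarrow> bool" where
  "val_tendsto v s x \<longleftrightarrow> (\<forall>N. \<exists>M. \<forall>n\<ge>M. Fin N \<le> v (s n - x))"

text \<open>
  \<open>(\<iota>, w)\<close> exhibits the codomain of \<open>\<iota>\<close> as the completion with respect to \<open>v\<close>:
  a complete valued field, with \<open>w\<close> extending \<open>v\<close> along \<open>\<iota>\<close>, in which the image of \<open>\<iota>\<close> is dense.
  This determines \<open>(\<iota>, w)\<close> up to unique isomorphism.
\<close>

definition is_completion ::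
    "('a::field \<Rightarrow> int extended) \<Rightarrow> ('b::field \<Rightarrow> int extended) \<Rightarrow> ('a \<Rightarrow> 'b) \<Rightarrow> bool" where
  "is_completion v w \<iota> \<longleftrightarrow>
     discrete_valuation w \<and>
     field_embedding \<iota> \<and>
     (\<forall>x. w (\<iota> x) = v x) \<and>
     (\<forall>y. \<exists>s. val_tendsto w (\<lambda>n. \<iota> (s n)) y) \<and>
     (\<forall>s. val_Cauchy w s \<longrightarrow> (\<exists>y. val_tendsto w s y))"

definition is_subfield :: "'a::field set \<Rightarrow> bool" where
  "is_subfield F \<longleftrightarrow>
     0 \<in> F \<and> 1 \<in> F \<and>
     (\<forall>x\<in>F. \<forall>y\<in>F. x - y \<in> F \<and> x * y \<in> F) \<and> (\<forall>x\<in>F. inverse x \<in> F)"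

section \<open>Valuations of the field of fractions of a power series ring\<close>

type_synonym ('k, 'n) psfield = "('k, 'n) mfps fract"

definition psfield_const :: "'k::field \<Rightarrow> ('k, 'n::finite) psfield" where
  "psfield_const c = to_fract (mfps_const c)"

definition trivial_on_constants :: "(('k::field, 'n::finite) psfield \<Rightarrow> int extended) \<Rightarrow> bool" where
  "trivial_on_constants v \<longleftrightarrow> (\<forall>c. c \<noteq> 0 \<longrightarrow> v (psfield_const c) = Fin 0)"

definition has_center ::
    "(('k::field, 'n::finite) psfield \<Rightarrow> int extended) \<Rightarrow> ('k, 'n) mfps set \<Rightarrow> bool" where
  "has_center v P \<longleftrightarrow>
     range to_fract \<subseteq> valuation_ring v \<and> to_fract -` valuation_ideal v = P"

definition mfps_X_ideal :: "('k::comm_ring_1, 'n::finite) mfps set" where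
  "mfps_X_ideal = {f. \<exists>g. f = (\<Sum>i\<in>UNIV. g i * mfps_X i)}"

section \<open>Monoidal transformations and changes of coordinates\<close>

text \<open>
  Each transformation is recorded by the coefficient field \<open>F\<close> and the current variables \<open>X\<close>
  before it, the homomorphism \<open>\<phi>\<close> from power series over \<open>F\<close> to power series over \<open>G\<close>, and the
  coefficient field \<open>G\<close> and variables \<open>Y\<close> after it.  The index \<open>i\<close> plays the role of \<open>1\<close> and \<open>j\<close>
  that of \<open>2\<close>, so that interchanges of variables are built in.  The condition
  \<open>w (X i) < w (X j)\<close> forces \<open>X i \<noteq> 0\<close>, but \<open>X j\<close> may be \<open>0\<close>.
\<close>

definition monoidal_transformation ::
    "('l::field \<Rightarrow> int extended) \<Rightarrow> 'n \<Rightarrow> 'n \<Rightarrow> 'l set \<Rightarrow> ('n \<Rightarrow> 'l) \<Rightarrow>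
     (('l, 'n::finite) mfps \<Rightarrow> ('l, 'n) mfps) \<Rightarrow> 'l set \<Rightarrow> ('n \<Rightarrow> 'l) \<Rightarrow> bool" where
  "monoidal_transformation w i j F X \<phi> G Y \<longleftrightarrow>
     i \<noteq> j \<and> w (X i) < w (X j) \<and>
     G = F \<and>
     \<phi> = restrict (mfps_subst (\<lambda>l. if l = j then mfps_X i * mfps_X j else mfps_X l)) (mfps_over F) \<and>
     Y = (\<lambda>l. if l = j then X j / X i else X l)"

definition coordinate_change ::
    "('l::field \<Rightarrow> int extended) \<Rightarrow> 'n \<Rightarrow> ('n \<Rightarrow> 'l) \<Rightarrow> 'l set \<Rightarrow> ('n \<Rightarrow> 'l) \<Rightarrow>
     (('l, 'n::finite) mfps \<Rightarrow> ('l, 'n) mfps) \<Rightarrow> 'l set \<Rightarrow> ('n \<Rightarrow> 'l) \<Rightarrow> bool" where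
  "coordinate_change w i c F X \<phi> G Y \<longleftrightarrow>
     is_subfield G \<and> F \<subseteq> G \<and> G \<subseteq> valuation_ring w \<and>
     (\<forall>l. l \<noteq> i \<longrightarrow> c l \<in> G \<and> c l \<in> valuation_ring w - valuation_ideal w) \<and>
     \<phi> = restrict
       (mfps_subst (\<lambda>l. if l = i then mfps_X i else mfps_X l + mfps_const (c l) * mfps_X i))
       (mfps_over F) \<and>
     Y = (\<lambda>l. if l = i then X i else X l - c l * X i)"

inductive transformation_sequence ::
    "('l::field \<Rightarrow> int extended) \<Rightarrow> 'l set \<Rightarrow> ('n \<Rightarrow> 'l) \<Rightarrow>
     (('l, 'n::finite) mfps \<Rightarrow> ('l, 'n) mfps) \<Rightarrow> 'l set \<Rightarrow> ('n \<Rightarrow> 'l) \<Rightarrow> bool"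
  for w F X where
    start: "transformation_sequence w F X (restrict id (mfps_over F)) F X"
  | monoidal: "transformation_sequence w F X \<phi> G Y \<Longrightarrow>
      monoidal_transformation w i j G Y \<psi> H Z \<Longrightarrow>
      transformation_sequence w F X (compose (mfps_over F) \<psi> \<phi>) H Z"
  | coordinates: "transformation_sequence w F X \<phi> G Y \<Longrightarrow>
      coordinate_change w i c G Y \<psi> H Z \<Longrightarrow>
      transformation_sequence w F X (compose (mfps_over F) \<psi> \<phi>) H Z"

end

theory Submission
  imports Defs
begin

text \<open>
  Fix a coefficient field \<open>D\<close> of the complete valuation ring containing \<open>k\<close>, and let \<open>n\<close> be the
  least finite value of a variable that can be reached with coefficients in \<open>D\<close>, attained by
  \<open>t = Y i\<close>. By minimality every reachable variable has value at least \<open>n\<close>; so from each \<open>Y l\<close> one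
  can subtract a multiple \<open>d t\<close>, \<open>d \<in> D\<close>, to raise the value above \<open>n\<close>, divide by \<open>t\<close>, and
  repeat forever. Hence all \<open>Y l\<close>, and with them the original variables and all power series
  in them, are limits of polynomials in \<open>t\<close> over \<open>D\<close>. Such limits have values divisible by \<open>n\<close>,
  while \<open>v\<close> takes the value \<open>1\<close>; so \<open>n = 1\<close>.
\<close>

section \<open>Polynomials over subrings\<close>

definition is_subring :: "'a::comm_ring_1 set \<Rightarrow> bool" where
  "is_subring S \<longleftrightarrow> 0 \<in> S \<and> 1 \<in> S \<and> (\<forall>x\<in>S. \<forall>y\<in>S. x - y \<in> S \<and> x * y \<in> S)"

lemma is_subringD:
  assumes "is_subring S"
  shows "0 \<in> S" "1 \<in> S"
    and "x \<in> S \<Longrightarrow> y \<in> S \<Longrightarrow> x - y \<in> S"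
    and "x \<in> S \<Longrightarrow> y \<in> S \<Longrightarrow> x * y \<in> S"
    and "x \<in> S \<Longrightarrow> - x \<in> S"
    and "x \<in> S \<Longrightarrow> y \<in> S \<Longrightarrow> x + y \<in> S"
proof -
  show "0 \<in> S" "1 \<in> S" "x \<in> S \<Longrightarrow> y \<in> S \<Longrightarrow> x - y \<in> S" "x \<in> S \<Longrightarrow> y \<in> S \<Longrightarrow> x * y \<in> S"
    using assms by (auto simp: is_subring_def)
  have uminus: "- z \<in> S" if "z \<in> S" for z
    using assms that unfolding is_subring_def by (metis diff_0)
  show "x \<in> S \<Longrightarrow> - x \<in> S"
    by (rule uminus)
  show "x \<in> S \<Longrightarrow> y \<in> S \<Longrightarrow> x + y \<in> S"
    using assms uminus[of y] unfolding is_subring_def by (metis diff_minus_eq_add)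
qed

lemma is_subring_sum:
  assumes "is_subring S" "\<And>i. i \<in> A \<Longrightarrow> f i \<in> S"
  shows "sum f A \<in> S"
  using assms(2) by (induction A rule: infinite_finite_induct) (auto intro: is_subringD[OF assms(1)])

lemma is_subfield_imp_subring: "is_subfield D \<Longrightarrow> is_subring D"
  by (auto simp: is_subfield_def is_subring_def)

lemma is_subfield_divide: "is_subfield D \<Longrightarrow> x \<in> D \<Longrightarrow> y \<in> D \<Longrightarrow> x / y \<in> D"
  by (auto simp: is_subfield_def field_class.field_divide_inverse)

text \<open>Supplies the upper bounds for Zorn's lemma. Any two elements of the union already lie in
  one member of the chain, so closure can be checked there.\<close>

lemma is_subfield_Union_chain:
  assumes "C \<noteq> {}" "subset.chain A C" "\<And>F. F \<in> A \<Longrightarrow> is_subfield F"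
  shows "is_subfield (\<Union>C)"
proof -
  have sub: "is_subfield F" if "F \<in> C" for F
    using assms that by (auto simp: subset_chain_def)
  have two: "\<exists>F\<in>C. x \<in> F \<and> y \<in> F" if "x \<in> \<Union>C" "y \<in> \<Union>C" for x y
    using assms(2) that unfolding subset_chain_def by (metis UnionE subsetD)
  obtain F where F: "F \<in> C"
    using assms(1) by auto
  show ?thesis
    unfolding is_subfield_def
  proof (intro conjI ballI)
    show "0 \<in> \<Union>C" "1 \<in> \<Union>C"
      using F sub[OF F] by (auto simp: is_subfield_def)
    show "x - y \<in> \<Union>C" "x * y \<in> \<Union>C" if "x \<in> \<Union>C" "y \<in> \<Union>C" for x y
      using two[OF that] sub by (auto simp: is_subfield_def)
    show "inverse x \<in> \<Union>C" if "x \<in> \<Union>C" for x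
      using that sub unfolding is_subfield_def by blast
  qed
qed

definition polys_over :: "'a::comm_ring_1 set \<Rightarrow> 'a poly set" where
  "polys_over S = {p. \<forall>i. coeff p i \<in> S}"

lemma polys_over_mono: "S \<subseteq> T \<Longrightarrow> polys_over S \<subseteq> polys_over T"
  by (auto simp: polys_over_def)

lemma pCons_in_polys_over_iff [simp]: "pCons a p \<in> polys_over S \<longleftrightarrow> a \<in> S \<and> p \<in> polys_over S"
  by (auto simp: polys_over_def coeff_pCons split: nat.splits)

lemma is_subring_polys_over:
  assumes "is_subring S"
  shows "is_subring (polys_over S)"
  by (auto simp: is_subring_def polys_over_def coeff_mult coeff_1
      intro: is_subringD[OF assms] is_subring_sum[OF assms])

lemma monom_in_polys_over: "is_subring S \<Longrightarrow> c \<in> S \<Longrightarrow> monom c n \<in> polys_over S"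
  by (auto simp: polys_over_def is_subringD)

lemma degree_pderiv_less:
  assumes "degree p > 0"
  shows "degree (pderiv p) < degree p"
  using assms by (intro degree_lessI) (auto simp: coeff_pderiv coeff_eq_0)

lemma pderiv_in_polys_over:
  assumes "is_subring S" "p \<in> polys_over S"
  shows "pderiv p \<in> polys_over S"
proof -
  have "of_nat n \<in> S" for n
    by (induction n) (auto intro: is_subringD[OF assms(1)])
  thus ?thesis
    using assms by (auto simp: polys_over_def coeff_pderiv intro!: is_subringD(4)
        simp del: of_nat_Suc)
qed

lemma poly_in_subring:
  assumes "is_subring S" "p \<in> polys_over S" "x \<in> S"
  shows "poly p x \<in> S"
  using assms(2) by (induction p) (auto intro: is_subringD[OF assms(1)] assms(3))

text \<open>The difference quotient of a polynomial is itself a polynomial in \<open>x\<close> and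
  \<open>y\<close> over \<open>S\<close>, built by Horner's scheme. Over the valuation ring it shows
  that congruent arguments give congruent values.\<close>

lemma poly_diff_factor:
  assumes "is_subring S" "p \<in> polys_over S" "x \<in> S" "y \<in> S"
  shows "\<exists>r\<in>S. poly p x - poly p y = (x - y) * r"
  using assms(2)
proof (induction p)
  case 0
  show ?case using is_subringD(1)[OF assms(1)] by (auto intro!: bexI[of _ 0])
next
  case (pCons a p)
  then obtain r where r: "r \<in> S" "poly p x - poly p y = (x - y) * r"
    by auto
  have "poly (pCons a p) x - poly (pCons a p) y = x * (poly p x - poly p y) + (x - y) * poly p y"
    by (simp add: algebra_simps)
  also have "\<dots> = (x - y) * (x * r + poly p y)"
    unfolding r by (simp add: algebra_simps)
  finally show ?case
    using pCons r assms by (auto intro!: bexI[of _ "x * r + poly p y"] is_subringD poly_in_subring)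
qed

text \<open>Only the second-order remainder is kept, which avoids dividing by factorials and so
  works over every subring. The induction follows Horner's scheme and the product rule.\<close>

lemma poly_taylor:
  assumes "is_subring S" "p \<in> polys_over S" "x \<in> S" "h \<in> S"
  shows "\<exists>r\<in>S. poly p (x + h) = poly p x + h * poly (pderiv p) x + h\<^sup>2 * r"
  using assms(2)
proof (induction p)
  case 0
  show ?case using is_subringD(1)[OF assms(1)] by (auto intro!: bexI[of _ 0])
next
  case (pCons a p)
  then obtain r where r: "r \<in> S" "poly p (x + h) = poly p x + h * poly (pderiv p) x + h\<^sup>2 * r"
    by auto
  have "poly (pCons a p) (x + h) = a + (x + h) * poly p (x + h)"
    by simp
  also have "\<dots> = poly (pCons a p) x + h * poly (pderiv (pCons a p)) x
      + h\<^sup>2 * (poly (pderiv p) x + (x + h) * r)"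
    unfolding r(2) by (simp add: pderiv_pCons algebra_simps power2_eq_square)
  finally have "poly (pCons a p) (x + h) = poly (pCons a p) x + h * poly (pderiv (pCons a p)) x
      + h\<^sup>2 * (poly (pderiv p) x + (x + h) * r)" .
  moreover have "poly (pderiv p) x + (x + h) * r \<in> S"
    using pCons r assms by (intro is_subringD poly_in_subring pderiv_in_polys_over) auto
  ultimately show ?case by blast
qed

section \<open>Discretely valued fields\<close>

locale discretely_valued =
  fixes w :: "'l::field \<Rightarrow> int extended"
  assumes valuation: "discrete_valuation w"
begin

text \<open>Integer lower bounds replace arithmetic in \<open>int extended\<close>. Zero satisfies
  all of them, so most estimates need no case distinction on infinite value.\<close>

definition val_ge :: "int \<Rightarrow> 'l \<Rightarrow> bool" where
  "val_ge n x \<longleftrightarrow> Fin n \<le> w x"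

lemma val_0: "w 0 = \<infinity>"
  using valuation by (simp add: discrete_valuation_def)

lemma val_mult: "w (x * y) = w x + w y"
  using valuation by (simp add: discrete_valuation_def)

lemma val_add: "min (w x) (w y) \<le> w (x + y)"
  using valuation by (simp add: discrete_valuation_def)

lemma val_finite:
  assumes "x \<noteq> 0"
  obtains n where "w x = Fin n"
proof -
  have "w x \<in> range Fin"
    using valuation assms unfolding discrete_valuation_def by blast
  thus thesis using that by blast
qed

lemma val_eq_infinity_iff: "w x = \<infinity> \<longleftrightarrow> x = 0"
  by (metis extended.distinct(1) val_0 val_finite)

lemma val_nonzero: "w x = Fin n \<Longrightarrow> x \<noteq> 0"
  using val_0 by auto

lemma val_ge_iff: "w x = Fin m \<Longrightarrow> val_ge n x \<longleftrightarrow> n \<le> m"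
  by (simp add: val_ge_def)

lemma val_1: "w 1 = Fin 0"
proof -
  obtain n where "w 1 = Fin n" using val_finite[of 1] by auto
  with val_mult[of 1 1] show ?thesis by simp
qed

lemma val_minus: "w (- x) = w x"
proof -
  obtain n where n: "w (-1) = Fin n" using val_finite[of "-1"] by auto
  with val_mult[of "-1" "-1"] val_1 have "n = 0" by simp
  thus ?thesis using n val_mult[of "-1" x] by (cases "w x") auto
qed

lemma val_ge_0 [simp]: "val_ge n 0"
  by (simp add: val_ge_def val_0)

lemma val_ge_1 [simp]: "val_ge 0 1"
  by (simp add: val_ge_def val_1)

lemma val_ge_mult: "val_ge m x \<Longrightarrow> val_ge n y \<Longrightarrow> val_ge (m + n) (x * y)"
  unfolding val_ge_def val_mult by (metis add_mono plus_extended.simps(1))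

lemma val_ge_mono: "val_ge m x \<Longrightarrow> n \<le> m \<Longrightarrow> val_ge n x"
  unfolding val_ge_def by (metis less_eq_extended.simps(1) order_trans)

lemma val_ge_add: "val_ge n x \<Longrightarrow> val_ge n y \<Longrightarrow> val_ge n (x + y)"
  unfolding val_ge_def using val_add[of x y] by (metis min.bounded_iff order_trans)

lemma val_ge_minus [simp]: "val_ge n (- x) \<longleftrightarrow> val_ge n x"
  by (simp add: val_ge_def val_minus)

lemma val_ge_diff: "val_ge n x \<Longrightarrow> val_ge n y \<Longrightarrow> val_ge n (x - y)"
  using val_ge_add[of n x "- y"] by simp

lemma val_ge_minus_commute: "val_ge n (x - y) \<longleftrightarrow> val_ge n (y - x)"
  using val_ge_minus[of n "x - y"] by simp

lemma val_ge_sum: "(\<And>i. i \<in> A \<Longrightarrow> val_ge n (f i)) \<Longrightarrow> val_ge n (sum f A)"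
  by (induction A rule: infinite_finite_induct) (auto intro: val_ge_add)

lemma val_ge_power: "val_ge 1 x \<Longrightarrow> val_ge (int n) (x ^ n)"
proof (induction n)
  case (Suc n)
  thus ?case using val_ge_mult[of 1 x "int n" "x ^ n"] by simp
qed auto

lemma val_ge_imp_0:
  assumes "\<And>n. val_ge (int n) x"
  shows "x = 0"
proof (rule ccontr)
  assume "x \<noteq> 0"
  then obtain n where "w x = Fin n" by (rule val_finite)
  with assms[of "nat (n + 1)"] show False by (auto simp: val_ge_iff split: if_splits)
qed

lemma val_eq_Fin_iff: "w x = Fin n \<longleftrightarrow> val_ge n x \<and> \<not> val_ge (n + 1) x"
  by (cases "w x") (auto simp: val_ge_def)

text \<open>The ultrametric inequality in both directions: a perturbation of strictly larger value
  cannot change a finite value.\<close>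

lemma val_cong: "w x = Fin n \<Longrightarrow> val_ge (n + 1) (x - y) \<Longrightarrow> w y = Fin n"
  unfolding val_eq_Fin_iff
  by (metis add_diff_cancel_left' diff_add_cancel minus_diff_eq val_ge_add val_ge_diff val_ge_mono
      zle_add1_eq_le zless_add1_eq)

lemma val_inverse: "w x = Fin n \<Longrightarrow> w (inverse x) = Fin (- n)"
proof -
  assume x: "w x = Fin n"
  hence "x \<noteq> 0" by (rule val_nonzero)
  hence "w x + w (inverse x) = Fin 0"
    by (metis right_inverse val_1 val_mult)
  with x show ?thesis by (cases "w (inverse x)") auto
qed

lemma val_ge_divide: "val_ge m x \<Longrightarrow> w y = Fin n \<Longrightarrow> val_ge (m - n) (x / y)"
  using val_ge_mult[of m x "- n" "inverse y"] val_inverse[of y n]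
  by (simp add: val_ge_iff field_class.field_divide_inverse)

lemma val_divide: "w x = Fin m \<Longrightarrow> w y = Fin n \<Longrightarrow> w (x / y) = Fin (m - n)"
  by (simp add: field_class.field_divide_inverse val_mult val_inverse)

lemma mem_valuation_ring: "x \<in> valuation_ring w \<longleftrightarrow> val_ge 0 x"
  by (simp add: valuation_ring_def val_ge_def)

lemma mem_valuation_ideal: "x \<in> valuation_ideal w \<longleftrightarrow> val_ge 1 x"
  by (cases "w x") (auto simp: valuation_ideal_def val_ge_def)

lemma unit_iff: "w x = Fin 0 \<longleftrightarrow> x \<in> valuation_ring w \<and> x \<notin> valuation_ideal w"
  unfolding val_eq_Fin_iff mem_valuation_ring mem_valuation_ideal by simp

lemma is_subring_valuation_ring: "is_subring (valuation_ring w)"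
  using val_ge_diff val_ge_mult[of 0 _ 0] by (auto simp: is_subring_def mem_valuation_ring)

lemma valuation_ring_cong:
  assumes "x \<in> valuation_ring w" "val_ge 1 (y - x)"
  shows "y \<in> valuation_ring w"
proof -
  have "val_ge 0 ((y - x) + x)"
    using assms by (intro val_ge_add) (auto simp: mem_valuation_ring elim: val_ge_mono)
  thus ?thesis by (simp add: mem_valuation_ring)
qed

section \<open>Subfields of the valuation ring and adjunction of elements\<close>

lemma subfield_unit:
  assumes "is_subfield D" "D \<subseteq> valuation_ring w" "x \<in> D" "x \<noteq> 0"
  shows "w x = Fin 0"
proof -
  obtain n where n: "w x = Fin n" using assms(4) by (rule val_finite)
  \<comment> \<open>The inverse is integral too, so neither \<open>n\<close> nor \<open>- n\<close>
    is negative.\<close>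
  have "inverse x \<in> D" using assms by (auto simp: is_subfield_def)
  hence "val_ge 0 x" "val_ge 0 (inverse x)"
    using assms mem_valuation_ring by auto
  thus ?thesis using n val_inverse[OF n] by (simp add: val_ge_iff)
qed

text \<open>The field \<open>D(y)\<close> is written out as fractions of polynomial values. The
  hypothesis makes every nonzero denominator a unit, hence all fractions integral; this treats
  algebraic and transcendental \<open>y\<close> alike.\<close>

lemma subfield_adjoin:
  assumes D: "is_subfield D" "D \<subseteq> valuation_ring w"
    and y: "\<And>q. q \<in> polys_over D \<Longrightarrow> poly q y = 0 \<or> w (poly q y) = Fin 0"
  shows "\<exists>E. is_subfield E \<and> insert y D \<subseteq> E \<and> E \<subseteq> valuation_ring w"
proof -
  note P = is_subringD[OF is_subring_polys_over[OF is_subfield_imp_subring[OF D(1)]]]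
  note S = is_subringD[OF is_subfield_imp_subring[OF D(1)]]
  define E where "E = {poly a y / poly b y |a b. a \<in> polys_over D \<and> b \<in> polys_over D \<and> poly b y \<noteq> 0}"
  have EI: "poly a y / poly b y \<in> E" if "a \<in> polys_over D" "b \<in> polys_over D" "poly b y \<noteq> 0" for a b
    using that by (auto simp: E_def)
  have poly_in: "poly a y \<in> E" if "a \<in> polys_over D" for a
    using EI[OF that P(2)] by simp
  have "is_subfield E"
    unfolding is_subfield_def
  proof (intro conjI ballI)
    show "0 \<in> E" using poly_in[OF P(1)] by simp
    show "1 \<in> E" using poly_in[OF P(2)] by simp
  next
    fix x z assume "x \<in> E" "z \<in> E"
    then obtain a b c d where *: "x = poly a y / poly b y" "z = poly c y / poly d y"
      "a \<in> polys_over D" "b \<in> polys_over D" "c \<in> polys_over D" "d \<in> polys_over D"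
      "poly b y \<noteq> 0" "poly d y \<noteq> 0"
      by (auto simp: E_def)
    have "x - z = poly (a * d - c * b) y / poly (b * d) y" "x * z = poly (a * c) y / poly (b * d) y"
      unfolding * using *(7,8) by (simp_all add: diff_frac_eq)
    moreover have "poly (a * d - c * b) y / poly (b * d) y \<in> E" "poly (a * c) y / poly (b * d) y \<in> E"
      using * by (intro EI P; simp)+
    ultimately show "x - z \<in> E" "x * z \<in> E"
      by simp_all
  next
    fix x assume "x \<in> E"
    then obtain a b where *: "x = poly a y / poly b y" "a \<in> polys_over D" "b \<in> polys_over D"
      by (auto simp: E_def)
    show "inverse x \<in> E"
    proof (cases "poly a y = 0")
      case True
      thus ?thesis using * poly_in[OF P(1)] by simp
    next
      case False
      thus ?thesis using * EI[of b a] by simp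
    qed
  qed
  moreover have "insert y D \<subseteq> E"
  proof -
    have "poly [:0, 1:] y \<in> E" "\<And>c. c \<in> D \<Longrightarrow> poly [:c:] y \<in> E"
      by (rule poly_in, use S P in simp)+
    thus ?thesis by auto
  qed
  moreover have "E \<subseteq> valuation_ring w"
  proof
    fix x assume "x \<in> E"
    then obtain a b where *: "x = poly a y / poly b y" "a \<in> polys_over D" "b \<in> polys_over D"
      "poly b y \<noteq> 0"
      by (auto simp: E_def)
    have "val_ge 0 (poly a y)"
      using y[OF *(2)] by (auto simp: val_ge_iff)
    moreover have "w (poly b y) = Fin 0"
      using y[OF *(3)] *(4) by simp
    ultimately show "x \<in> valuation_ring w"
      using val_ge_divide[of 0 "poly a y" "poly b y" 0] * by (simp add: mem_valuation_ring)
  qed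
  ultimately show ?thesis by blast
qed

text \<open>Euclidean division by \<open>p\<close>, one leading term at a time: since
  \<open>y\<close> is a root of \<open>p\<close>, subtracting a multiple of \<open>p\<close> lowers
  the degree without changing the value at \<open>y\<close>, until \<open>small\<close>
  applies.\<close>

lemma subfield_poly_eq_0_or_unit:
  assumes D: "is_subfield D" "D \<subseteq> valuation_ring w"
    and p: "p \<in> polys_over D" "p \<noteq> 0" "poly p y = 0"
    and small: "\<And>q. q \<in> polys_over D \<Longrightarrow> q \<noteq> 0 \<Longrightarrow> degree q < degree p \<Longrightarrow> w (poly q y) = Fin 0"
    and "q \<in> polys_over D"
  shows "poly q y = 0 \<or> w (poly q y) = Fin 0"
  using \<open>q \<in> polys_over D\<close>
proof (induction "degree q" arbitrary: q rule: less_induct)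
  case less
  note S = is_subfield_imp_subring[OF D(1)]
  note P = is_subringD[OF is_subring_polys_over[OF S]]
  consider "q = 0" | "q \<noteq> 0" "degree q < degree p" | "q \<noteq> 0" "degree p \<le> degree q"
    by linarith
  thus ?case
  proof cases
    case 3
    define c where "c = lead_coeff q / lead_coeff p"
    define m where "m = monom c (degree q - degree p)"
    define r where "r = q - m * p"
    have c: "c \<noteq> 0" "c \<in> D"
      using 3 p less.prems D by (auto simp: c_def polys_over_def intro!: is_subfield_divide)
    have r: "r \<in> polys_over D"
      unfolding r_def m_def using p c less.prems by (auto intro!: P monom_in_polys_over S)
    have "degree (m * p) = degree q"
      using 3 p c by (simp add: m_def degree_mult_eq degree_monom_eq)
    moreover have "lead_coeff (m * p) = lead_coeff q"
      using p c by (simp add: m_def lead_coeff_mult degree_monom_eq lead_coeff_monom c_def)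
    ultimately have "r = 0 \<or> degree r < degree q"
      using eq_zero_or_degree_less[of r "degree q"] degree_diff_le[of q "degree q" "m * p"]
      by (simp add: r_def)
    moreover have "poly r y = poly q y"
      by (simp add: r_def p)
    ultimately show ?thesis
      using less.hyps[of r] r by (metis poly_0)
  qed (use small less.prems in auto)
qed

end

section \<open>Coefficient fields of complete valuation rings\<close>

locale complete_discretely_valued = discretely_valued w
  for w :: "'l::field \<Rightarrow> int extended" +
  assumes complete: "val_Cauchy w s \<Longrightarrow> \<exists>y. val_tendsto w s y"
begin

text \<open>In the ultrametric setting bounds on consecutive differences bound all later
  differences, so the limit comes with an explicit rate.\<close>

lemma fast_Cauchy_limit:
  assumes "\<And>n. val_ge (int n) (s (Suc n) - s n)"
  shows "\<exists>y. \<forall>n. val_ge (int n) (y - s n)"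
proof -
  have step: "val_ge (int n) (s (n + k) - s n)" for n k
  proof (induction k)
    case (Suc k)
    have "val_ge (int n) (s (Suc (n + k)) - s (n + k))"
      using assms[of "n + k"] by (rule val_ge_mono) simp
    from val_ge_add[OF this Suc] show ?case by simp
  qed simp
  have le: "val_ge (int n) (s m - s n)" if "n \<le> m" for m n
    using step[of n "m - n"] that by simp
  have "val_Cauchy w s"
    unfolding val_Cauchy_def val_ge_def[symmetric]
  proof (intro allI exI[of _ "nat _"] impI)
    fix N :: int and m n assume "nat N \<le> m" "nat N \<le> n"
    hence "val_ge (int (nat N)) ((s m - s (nat N)) - (s n - s (nat N)))"
      by (intro val_ge_diff le)
    thus "val_ge N (s m - s n)"
      by (auto elim: val_ge_mono)
  qed
  then obtain y where y: "val_tendsto w s y"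
    using complete by blast
  have "val_ge (int n) (y - s n)" for n
  proof -
    obtain M where M: "\<And>m. m \<ge> M \<Longrightarrow> val_ge (int n) (s m - y)"
      using y unfolding val_tendsto_def val_ge_def by blast
    \<comment> \<open>The index \<open>max M n\<close> is late enough to be close both to
      \<open>s n\<close> and to the limit.\<close>
    from val_ge_diff[OF le[of n "max M n"] M[of "max M n"]] show ?thesis by simp
  qed
  thus ?thesis by blast
qed

text \<open>
  The slope \<open>p'(x)\<close> is kept fixed in the Newton iteration; linear convergence is enough.
\<close>

lemma hensel:
  assumes p: "p \<in> polys_over (valuation_ring w)" and x: "x \<in> valuation_ring w"
    and root: "val_ge 1 (poly p x)" and simple: "w (poly (pderiv p) x) = Fin 0"
  shows "\<exists>y. poly p y = 0 \<and> val_ge 1 (y - x)"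
proof -
  note R = is_subring_valuation_ring
  define u where "u = poly (pderiv p) x"
  have u: "w u = Fin 0" "u \<noteq> 0"
    using simple val_nonzero by (auto simp: u_def)
  define s where "s = rec_nat x (\<lambda>_ y. y - poly p y / u)"
  have s_Suc: "s (Suc n) = s n - poly p (s n) / u" for n
    by (simp add: s_def)
  \<comment> \<open>Staying congruent to \<open>x\<close> keeps the true slope congruent to the
    fixed slope \<open>u\<close>; each step then gains one order in the error.\<close>
  have inv: "val_ge 1 (s n - x) \<and> val_ge (int n + 1) (poly p (s n))" for n
  proof (induction n)
    case 0
    show ?case using root by (simp add: s_def)
  next
    case (Suc n)
    define h where "h = - (poly p (s n) / u)"
    have h: "val_ge (int n + 1) h"
      using Suc val_ge_divide[of "int n + 1" _ u 0] u by (simp add: h_def)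
    have hR: "h \<in> valuation_ring w"
      using h by (auto simp: mem_valuation_ring intro: val_ge_mono)
    have sR: "s n \<in> valuation_ring w"
      using valuation_ring_cong[OF x] Suc by blast
    obtain r where r: "r \<in> valuation_ring w"
      "poly p (s n + h) = poly p (s n) + h * poly (pderiv p) (s n) + h\<^sup>2 * r"
      using poly_taylor[OF R p sR hR] by blast
    obtain q where q: "q \<in> valuation_ring w"
      "poly (pderiv p) (s n) - poly (pderiv p) x = (s n - x) * q"
      using poly_diff_factor[OF R pderiv_in_polys_over[OF R p] sR x] by blast
    have "poly p (s n) = - (h * u)"
      using u by (simp add: h_def)
    \<comment> \<open>In Taylor's formula \<open>poly p (s n)\<close> cancels against
      \<open>h * u\<close>, leaving \<open>h\<close> times the deviation of the slope and the
      quadratic remainder. Both have value at least \<open>n + 2\<close>.\<close>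
    hence eq: "poly p (s (Suc n)) = h * ((s n - x) * q) + h * h * r"
      unfolding q(2)[symmetric] s_Suc using r(2)
      by (simp add: h_def u_def[symmetric] algebra_simps power2_eq_square)
    have "val_ge ((int n + 1) + (1 + 0)) (h * ((s n - x) * q))"
      using Suc h q by (intro val_ge_mult) (auto simp: mem_valuation_ring)
    moreover have "val_ge ((int n + 1) + (int n + 1) + 0) (h * h * r)"
      using h r by (intro val_ge_mult) (auto simp: mem_valuation_ring)
    ultimately have "val_ge (int (Suc n) + 1) (poly p (s (Suc n)))"
      unfolding eq by (intro val_ge_add) (auto elim: val_ge_mono)
    moreover have "val_ge 1 ((s n - x) + h)"
      using Suc h by (intro val_ge_add) (auto elim: val_ge_mono)
    ultimately show ?case
      by (simp add: s_Suc h_def algebra_simps)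
  qed
  have "val_ge (int n) (s (Suc n) - s n)" for n
  proof -
    have "val_ge (int n + 1 - 0) (poly p (s n) / u)"
      using inv u by (intro val_ge_divide) auto
    thus ?thesis by (auto simp: s_Suc elim: val_ge_mono)
  qed
  then obtain y where y: "\<And>n. val_ge (int n) (y - s n)"
    using fast_Cauchy_limit by blast
  have "val_ge 1 ((y - s 1) + (s 1 - x))"
    using y[of 1] inv[of 1] by (intro val_ge_add) auto
  hence yx: "val_ge 1 (y - x)" by simp
  have sR: "s n \<in> valuation_ring w" for n
    using valuation_ring_cong[OF x] inv[of n] by blast
  have yR: "y \<in> valuation_ring w"
    using valuation_ring_cong[OF x yx] .
  have "val_ge (int n) (poly p y)" for n
  proof -
    obtain r where r: "r \<in> valuation_ring w" "poly p y - poly p (s n) = (y - s n) * r"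
      using poly_diff_factor[OF R p yR sR] by blast
    have "val_ge (int n + 0) ((y - s n) * r)"
      using y r by (intro val_ge_mult) (auto simp: mem_valuation_ring)
    hence "val_ge (int n) ((poly p y - poly p (s n)) + poly p (s n))"
      using inv[of n] unfolding r(2) by (intro val_ge_add) (auto elim: val_ge_mono)
    thus ?thesis by simp
  qed
  hence "poly p y = 0"
    by (rule val_ge_imp_0)
  with yx show ?thesis by blast
qed

text \<open>
  A subfield of the valuation ring maximal with respect to inclusion maps onto the residue field:
  a residue outside its image could be adjoined, using Hensel's lemma when it is algebraic.
\<close>

lemma coefficient_field_exists:
  assumes F: "is_subfield F" "F \<subseteq> valuation_ring w"
    and char0: "\<And>n. n > 0 \<Longrightarrow> of_nat n \<noteq> (0 :: 'l)"
  shows "\<exists>D. is_subfield D \<and> F \<subseteq> D \<and> D \<subseteq> valuation_ring w \<and>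
    (\<forall>x\<in>valuation_ring w. \<exists>d\<in>D. val_ge 1 (x - d))"
proof -
  define A where "A = {G. is_subfield G \<and> F \<subseteq> G \<and> G \<subseteq> valuation_ring w}"
  have "A \<noteq> {}" using F by (auto simp: A_def)
  moreover have "\<Union>C \<in> A" if "C \<noteq> {}" "subset.chain A C" for C
  proof -
    have "is_subfield (\<Union>C)"
      using that by (rule is_subfield_Union_chain) (auto simp: A_def)
    moreover have "C \<subseteq> A" using that by (auto simp: subset_chain_def)
    ultimately show ?thesis using that(1) by (auto simp: A_def)
  qed
  ultimately obtain D where "D \<in> A" and max: "\<And>G. G \<in> A \<Longrightarrow> D \<subseteq> G \<Longrightarrow> G = D"
    using subset_Zorn_nonempty[of A] by blast
  hence D: "is_subfield D" "F \<subseteq> D" "D \<subseteq> valuation_ring w"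
    by (auto simp: A_def)
  note S = is_subfield_imp_subring[OF D(1)]
  \<comment> \<open>By maximality, whatever can be adjoined inside the valuation ring is already in
    \<open>D\<close>.\<close>
  have adjoin: "y \<in> D" if "\<And>q. q \<in> polys_over D \<Longrightarrow> poly q y = 0 \<or> w (poly q y) = Fin 0" for y
  proof -
    have "\<exists>E. is_subfield E \<and> insert y D \<subseteq> E \<and> E \<subseteq> valuation_ring w"
      using that by (rule subfield_adjoin[OF D(1,3)])
    then obtain E where "is_subfield E" "insert y D \<subseteq> E" "E \<subseteq> valuation_ring w"
      by blast
    thus ?thesis using max[of E] D by (auto simp: A_def)
  qed
  have "\<exists>d\<in>D. val_ge 1 (x - d)" if x: "x \<in> valuation_ring w" for x
  proof -
    have poly_R: "poly q z \<in> valuation_ring w"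
      if "q \<in> polys_over D" "z \<in> valuation_ring w" for q z
      using poly_in_subring[OF is_subring_valuation_ring _ that(2)] that(1) polys_over_mono[OF D(3)]
      by blast
    show ?thesis
    proof (cases "\<exists>p. p \<in> polys_over D \<and> p \<noteq> 0 \<and> val_ge 1 (poly p x)")
      \<comment> \<open>The residue of \<open>x\<close> is transcendental over \<open>D\<close>:
        nonzero polynomials take unit values at \<open>x\<close>, so \<open>x\<close> itself can be
        adjoined.\<close>
      case False
      hence "poly q x = 0 \<or> w (poly q x) = Fin 0" if "q \<in> polys_over D" for q
        using that poly_R[OF that x] unfolding unit_iff mem_valuation_ideal by auto
      from adjoin[OF this] show ?thesis by (intro bexI[of _ x]) auto
    next
      case True
      \<comment> \<open>Least degree makes \<open>p\<close> a minimal polynomial of the residue of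
        \<open>x\<close>, up to a scalar.\<close>
      then obtain p where p: "p \<in> polys_over D" "p \<noteq> 0" "val_ge 1 (poly p x)"
        and least: "\<And>q. q \<in> polys_over D \<Longrightarrow> q \<noteq> 0 \<Longrightarrow> val_ge 1 (poly q x) \<Longrightarrow> degree p \<le> degree q"
        using ex_has_least_nat[of "\<lambda>p. p \<in> polys_over D \<and> p \<noteq> 0 \<and> val_ge 1 (poly p x)" _ degree]
        by blast
      have small: "w (poly q x) = Fin 0" if "q \<in> polys_over D" "q \<noteq> 0" "degree q < degree p" for q
        using least[OF that(1,2)] that(3) poly_R[OF that(1) x]
        unfolding unit_iff mem_valuation_ideal by auto
      have deg: "degree p > 0"
      proof (rule ccontr)
        assume "\<not> degree p > 0"
        then obtain c where c: "p = [:c:]" by (auto elim: degree_eq_zeroE)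
        hence "w c = Fin 0" using p D by (intro subfield_unit) auto
        with p c show False by (simp add: val_ge_iff)
      qed
      \<comment> \<open>Characteristic zero gives separability: the derivative is nonzero of smaller
        degree, so by minimality its value at \<open>x\<close> is a unit.\<close>
      have "coeff (pderiv p) (degree p - 1) \<noteq> 0"
        using deg p char0[of "degree p"] by (simp add: coeff_pderiv del: of_nat_Suc)
      hence "w (poly (pderiv p) x) = Fin 0"
        using deg p by (intro small pderiv_in_polys_over S) (auto simp: degree_pderiv_less)
      then obtain y where y: "poly p y = 0" "val_ge 1 (y - x)"
        using hensel[of p x] p x polys_over_mono[OF D(3)] by blast
      have yR: "y \<in> valuation_ring w"
        using valuation_ring_cong[OF x y(2)] .
      \<comment> \<open>The lift \<open>y\<close> has the same residue as \<open>x\<close>, so the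
        unit values of low-degree polynomials carry over.\<close>
      have "w (poly q y) = Fin 0" if q: "q \<in> polys_over D" "q \<noteq> 0" "degree q < degree p" for q
      proof (rule val_cong[OF small[OF q]])
        obtain r where r: "r \<in> valuation_ring w" "poly q x - poly q y = (x - y) * r"
          using poly_diff_factor[OF is_subring_valuation_ring _ x yR] q polys_over_mono[OF D(3)]
          by blast
        have "val_ge (1 + 0) ((x - y) * r)"
          using y r val_ge_minus_commute by (intro val_ge_mult) (auto simp: mem_valuation_ring)
        thus "val_ge (0 + 1) (poly q x - poly q y)" using r by simp
      qed
      hence "y \<in> D"
        using subfield_poly_eq_0_or_unit[OF D(1,3) p(1,2) y(1)] by (intro adjoin) blast
      thus ?thesis using y val_ge_minus_commute by blast
    qed
  qed
  thus ?thesis using D by blast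
qed

end

section \<open>Power series\<close>

lemma mfps_coeff_const: "mfps_coeff (mfps_const c) a = (if a = 0 then c else 0)"
  by (simp add: mfps_const_def)

lemma mfps_const_1: "mfps_const 1 = 1"
  by (simp add: mfps_eq_iff mfps_coeff_const mfps_coeff_one)

lemma mfps_const_add: "mfps_const (c + d) = mfps_const c + mfps_const d"
  by (simp add: mfps_eq_iff mfps_coeff_const)

lemma mfps_const_mult:
  "mfps_const (c * d) = mfps_const c * (mfps_const d :: ('a::comm_ring_1, 'n::finite) mfps)"
proof (rule mfps_eqI)
  fix a :: "'n \<Rightarrow> nat"
  have "mfps_coeff (mfps_const c * (mfps_const d :: ('a, 'n) mfps)) a
      = (\<Sum>p\<in>splits a. if p = (0, 0) then c * d else 0)"
    unfolding mfps_coeff_mult by (rule sum.cong) (auto simp: mfps_coeff_const split: if_splits)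
  also have "\<dots> = mfps_coeff (mfps_const (c * d)) a"
    by (subst sum.delta[OF finite_splits]) (auto simp: splits_def mfps_coeff_const)
  finally show "mfps_coeff (mfps_const (c * d)) a
      = mfps_coeff (mfps_const c * (mfps_const d :: ('a, 'n) mfps)) a" ..
qed

lemma mfps_coeff_sum: "mfps_coeff (sum f A) a = (\<Sum>i\<in>A. mfps_coeff (f i) a)"
  by (induction A rule: infinite_finite_induct) auto

lemma mfps_coeff_mult_X:
  fixes a e :: "'n::finite \<Rightarrow> nat"
  assumes "e = (\<lambda>j. if j = i then 1 else 0)"
  shows "mfps_coeff (g * mfps_X i) a = (if a i > 0 then mfps_coeff g (a - e) else 0)"
proof -
  have cancel: "b + e - e = b" for b
    by (simp add: fun_eq_iff)
  have "mfps_coeff (g * mfps_X i) a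
      = (\<Sum>p\<in>splits a. if p = (a - e, e) then mfps_coeff g (a - e) else 0)"
    unfolding mfps_coeff_mult mfps_X_def assms[symmetric]
    by (rule sum.cong) (auto simp: splits_def cancel split: if_splits)
  also have "\<dots> = (if (a - e, e) \<in> splits a then mfps_coeff g (a - e) else 0)"
    by (rule sum.delta) simp
  also have "(a - e, e) \<in> splits a \<longleftrightarrow> a i > 0"
    by (auto simp: splits_def fun_eq_iff assms)
  finally show ?thesis .
qed

text \<open>Each nonconstant monomial is assigned to exactly one variable \<open>s a\<close>
  occurring in it; \<open>g i\<close> collects the monomials assigned to \<open>i\<close>, with that
  exponent lowered by one. The arbitrary choice at exponent 0 is harmless, since the constant term
  is split off.\<close>

lemma mfps_decompose:
  fixes f :: "('a::comm_ring_1, 'n::finite) mfps"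
  shows "\<exists>g. f = mfps_const (mfps_coeff f 0) + (\<Sum>i\<in>UNIV. g i * mfps_X i)"
proof -
  define e :: "'n \<Rightarrow> 'n \<Rightarrow> nat" where "e i = (\<lambda>j. if j = i then 1 else 0)" for i
  define s :: "('n \<Rightarrow> nat) \<Rightarrow> 'n" where "s a = (SOME i. a i > 0)" for a
  define g where "g i = Abs_mfps (\<lambda>b. if s (b + e i) = i then mfps_coeff f (b + e i) else 0)" for i
  have "f = mfps_const (mfps_coeff f 0) + (\<Sum>i\<in>UNIV. g i * mfps_X i)"
  proof (rule mfps_eqI)
    fix a
    have restore: "a - e i + e i = a" if "a i > 0" for i
      using that by (auto simp: fun_eq_iff e_def)
    have coeff: "mfps_coeff (g i * mfps_X i) a
        = (if i = s a then (if a i > 0 then mfps_coeff f a else 0) else 0)" for i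
      unfolding mfps_coeff_mult_X[OF e_def] by (auto simp: g_def restore)
    have "mfps_coeff (\<Sum>i\<in>UNIV. g i * mfps_X i) a = (if a (s a) > 0 then mfps_coeff f a else 0)"
      unfolding mfps_coeff_sum coeff by (subst sum.delta) auto
    moreover have "a (s a) > 0 \<longleftrightarrow> a \<noteq> 0"
    proof
      assume "a \<noteq> 0"
      then obtain i where "a i > 0" by (auto simp: fun_eq_iff)
      thus "a (s a) > 0" unfolding s_def by (rule someI)
    qed auto
    ultimately show "mfps_coeff f a
        = mfps_coeff (mfps_const (mfps_coeff f 0) + (\<Sum>i\<in>UNIV. g i * mfps_X i)) a"
      by (auto simp: mfps_coeff_const)
  qed
  thus ?thesis by blast
qed

lemma mfps_X_nonzero: "mfps_X i \<noteq> (0 :: ('a::comm_ring_1, 'n::finite) mfps)"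
  by (auto simp: mfps_eq_iff mfps_X_def)

lemma mfps_X_in_ideal: "mfps_X i \<in> (mfps_X_ideal :: ('a::comm_ring_1, 'n::finite) mfps set)"
proof -
  have "mfps_X i = (\<Sum>j\<in>UNIV. (if j = i then 1 else 0) * (mfps_X j :: ('a, 'n) mfps))"
    by (subst sum.cong[OF refl, where h = "\<lambda>j. if j = i then mfps_X j else 0"]) auto
  thus ?thesis unfolding mfps_X_ideal_def by (intro CollectI exI)
qed

section \<open>Field embeddings and their images\<close>

lemma field_embedding_psfield_const: "field_embedding psfield_const"
  by (simp add: field_embedding_def psfield_const_def mfps_const_1 mfps_const_add mfps_const_mult)

lemma field_embedding_0: "field_embedding e \<Longrightarrow> e 0 = 0"
  unfolding field_embedding_def by (metis add_cancel_right_right)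

lemma field_embedding_of_nat: "field_embedding e \<Longrightarrow> e (of_nat n) = of_nat n"
  by (induction n) (simp add: field_embedding_0, simp add: field_embedding_def)

lemma field_embedding_comp: "field_embedding e \<Longrightarrow> field_embedding f \<Longrightarrow> field_embedding (\<lambda>x. f (e x))"
  by (simp add: field_embedding_def)

lemma is_subfield_range:
  assumes e: "field_embedding e"
  shows "is_subfield (range e)"
proof -
  have add: "e (x + y) = e x + e y" and mult: "e (x * y) = e x * e y" and one: "e 1 = 1" for x y
    using e by (auto simp: field_embedding_def)
  have "e x - e y = e (x - y)" for x y
    using add[of "x - y" y] by simp
  moreover have "inverse (e x) = e (inverse x)" for x
  proof (cases "x = 0")
    case True
    thus ?thesis using field_embedding_0[OF e] by simp
  next
    case False
    hence "e x * e (inverse x) = 1"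
      using mult[of x "inverse x"] one by simp
    thus ?thesis by (rule inverse_unique)
  qed
  moreover have "e x * e y \<in> range e" for x y
    by (metis mult rangeI)
  moreover have "0 \<in> range e" "1 \<in> range e"
    using field_embedding_0[OF e] one by (metis rangeI)+
  ultimately show ?thesis
    by (auto simp: is_subfield_def)
qed

section \<open>Limits of polynomials in one element\<close>

context discretely_valued
begin

text \<open>The closure of \<open>D[t]\<close> in the valuation topology. It plays the role of the
  ring \<open>D[[t]]\<close> and is described by approximations, so no infinite sums have to be
  formed.\<close>

definition polynomial_limits :: "'l set \<Rightarrow> 'l \<Rightarrow> 'l set" where
  "polynomial_limits D t = {x. \<forall>m. \<exists>p\<in>polys_over D. val_ge (int m) (x - poly p t)}"

context
  fixes D t
  assumes D: "is_subfield D" "D \<subseteq> valuation_ring w" and t: "val_ge 1 t"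
begin

lemma poly_in_valuation_ring:
  assumes "p \<in> polys_over D"
  shows "poly p t \<in> valuation_ring w"
  using assms t polys_over_mono[OF D(2)] val_ge_mono[of 1 t 0]
  by (intro poly_in_subring is_subring_valuation_ring) (auto simp: mem_valuation_ring)

lemma poly_in_polynomial_limits: "p \<in> polys_over D \<Longrightarrow> poly p t \<in> polynomial_limits D t"
  by (auto simp: polynomial_limits_def intro!: bexI[of _ p])

lemma subfield_subset_polynomial_limits: "D \<subseteq> polynomial_limits D t"
proof
  fix c assume "c \<in> D"
  hence "[:c:] \<in> polys_over D"
    using is_subringD(1)[OF is_subring_polys_over[OF is_subfield_imp_subring[OF D(1)]]] by simp
  from poly_in_polynomial_limits[OF this] show "c \<in> polynomial_limits D t" by simp
qed

lemma polynomial_limits_subset: "polynomial_limits D t \<subseteq> valuation_ring w"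
proof
  fix x assume "x \<in> polynomial_limits D t"
  then obtain p where p: "p \<in> polys_over D" "val_ge (int 1) (x - poly p t)"
    unfolding polynomial_limits_def by blast
  thus "x \<in> valuation_ring w"
    using valuation_ring_cong[OF poly_in_valuation_ring[OF p(1)]] by simp
qed

text \<open>The two factors enter asymmetrically: poor precision \<open>k\<close> in the first is
  compensated by the value \<open>l\<close> of the second. Products of limits use
  \<open>l = 0\<close>, power series use \<open>l = 1\<close>.\<close>

lemma val_ge_mult_diff:
  assumes "val_ge k (x - p)" "val_ge l y" "k + l \<ge> m" "val_ge 0 p" "val_ge m (y - q)"
  shows "val_ge m (x * y - p * q)"
proof -
  have "val_ge m ((x - p) * y + p * (y - q))"
    using val_ge_mult[OF assms(1,2)] val_ge_mult[OF assms(4,5)] assms(3)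
    by (intro val_ge_add) (auto elim: val_ge_mono)
  thus ?thesis by (simp add: algebra_simps)
qed

lemma is_subring_polynomial_limits: "is_subring (polynomial_limits D t)"
  unfolding is_subring_def
proof (intro conjI ballI)
  note P = is_subringD[OF is_subring_polys_over[OF is_subfield_imp_subring[OF D(1)]]]
  show "0 \<in> polynomial_limits D t" "1 \<in> polynomial_limits D t"
    using subfield_subset_polynomial_limits D(1) by (auto simp: is_subfield_def)
  fix x y assume xy: "x \<in> polynomial_limits D t" "y \<in> polynomial_limits D t"
  have "\<exists>p\<in>polys_over D. val_ge (int m) (x - y - poly p t)"
    and "\<exists>p\<in>polys_over D. val_ge (int m) (x * y - poly p t)" for m
  proof -
    obtain p q where p: "p \<in> polys_over D" "val_ge (int m) (x - poly p t)"
      and q: "q \<in> polys_over D" "val_ge (int m) (y - poly q t)"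
      using xy unfolding polynomial_limits_def by blast
    have "x - y - poly (p - q) t = (x - poly p t) - (y - poly q t)"
      by simp
    hence "val_ge (int m) (x - y - poly (p - q) t)"
      using val_ge_diff[OF p(2) q(2)] by (simp only:)
    thus "\<exists>p\<in>polys_over D. val_ge (int m) (x - y - poly p t)"
      using P(3)[OF p(1) q(1)] by blast
    have "val_ge 0 y" "val_ge 0 (poly p t)"
      using xy polynomial_limits_subset poly_in_valuation_ring[OF p(1)]
      by (auto simp: mem_valuation_ring)
    hence "val_ge (int m) (x * y - poly (p * q) t)"
      using val_ge_mult_diff[OF p(2) _ _ _ q(2), of 0] by simp
    thus "\<exists>p\<in>polys_over D. val_ge (int m) (x * y - poly p t)"
      using P(4)[OF p(1) q(1)] by blast
  qed
  thus "x - y \<in> polynomial_limits D t" "x * y \<in> polynomial_limits D t"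
    by (auto simp: polynomial_limits_def)
qed

text \<open>Nonzero coefficients are units and \<open>t\<close> has positive value, so the lowest
  nonzero term dominates and the value is \<open>n\<close> times its exponent. The induction strips
  zero constant terms, each contributing one factor \<open>t\<close>.\<close>

lemma val_poly_dvd:
  assumes n: "w t = Fin n" and p: "p \<in> polys_over D" and "poly p t \<noteq> 0"
  shows "\<exists>k. w (poly p t) = Fin k \<and> n dvd k"
  using p \<open>poly p t \<noteq> 0\<close>
proof (induction p)
  case (pCons a p)
  show ?case
  proof (cases "a = 0")
    case True
    with pCons obtain k where "w (poly p t) = Fin k" "n dvd k" by auto
    thus ?thesis using True n by (simp add: val_mult)
  next
    case False
    have "w a = Fin 0"
      using pCons False D by (intro subfield_unit) auto
    moreover have "val_ge 0 (poly p t)"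
      using poly_in_valuation_ring pCons.prems by (simp add: mem_valuation_ring)
    hence "val_ge (1 + 0) (t * poly p t)"
      using t by (intro val_ge_mult)
    hence "val_ge (0 + 1) (a - poly (pCons a p) t)"
      by simp
    ultimately have "w (poly (pCons a p) t) = Fin 0"
      by (rule val_cong)
    thus ?thesis by simp
  qed
qed simp

lemma val_polynomial_limits_dvd:
  assumes n: "w t = Fin n" and x: "x \<in> polynomial_limits D t" "x \<noteq> 0"
  shows "\<exists>k. w x = Fin k \<and> n dvd k"
proof -
  obtain k where k: "w x = Fin k" using x(2) by (rule val_finite)
  \<comment> \<open>Precision beyond the value \<open>k\<close> of \<open>x\<close> forces the
    approximating polynomial to have the same value.\<close>
  obtain p where p: "p \<in> polys_over D" "val_ge (int (nat (k + 1))) (x - poly p t)"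
    using x(1) unfolding polynomial_limits_def by blast
  have "w (poly p t) = Fin k"
    using k p(2) by (rule val_cong[OF _ val_ge_mono]) simp
  with val_poly_dvd[OF n p(1)] val_nonzero[of "poly p t"] k show ?thesis by auto
qed

text \<open>
  Power series need not be truncated: splitting off one variable at a time gains one order of
  precision per step.
\<close>

lemma power_series_in_polynomial_limits:
  fixes h :: "('a::comm_ring_1, 'n::finite) mfps \<Rightarrow> 'l"
  assumes add: "\<And>f g. h (f + g) = h f + h g" and mult: "\<And>f g. h (f * g) = h f * h g"
    and const: "\<And>c. h (mfps_const c) \<in> D" and integral: "\<And>f. h f \<in> valuation_ring w"
    and X_pos: "\<And>i. val_ge 1 (h (mfps_X i))"
    and X: "\<And>i. h (mfps_X i) \<in> polynomial_limits D t"
  shows "h f \<in> polynomial_limits D t"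
proof -
  note P = is_subring_polys_over[OF is_subfield_imp_subring[OF D(1)]]
  have h0: "h 0 = 0" using add[of 0 0] by (metis add.right_neutral add_left_cancel)
  have h_sum: "h (sum u A) = (\<Sum>i\<in>A. h (u i))" for u and A :: "'n set"
    by (induction A rule: infinite_finite_induct) (simp_all add: h0 add)
  have "\<exists>p\<in>polys_over D. val_ge (int m) (h f - poly p t)" for m
  proof (induction m arbitrary: f)
    case 0
    show ?case
      using integral[of f] is_subringD(1)[OF P] by (auto simp: mem_valuation_ring intro!: bexI[of _ 0])
  next
    case (Suc m)
    obtain g where g: "f = mfps_const (mfps_coeff f 0) + (\<Sum>i\<in>UNIV. g i * mfps_X i)"
      using mfps_decompose by blast
    have f: "h f = h (mfps_const (mfps_coeff f 0)) + (\<Sum>i\<in>UNIV. h (g i) * h (mfps_X i))"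
      using arg_cong[OF g, of h] by (simp only: add h_sum mult)
    have "\<forall>i. \<exists>p\<in>polys_over D. val_ge (int m) (h (g i) - poly p t)"
      using Suc by blast
    then obtain p where p: "\<And>i. p i \<in> polys_over D" "\<And>i. val_ge (int m) (h (g i) - poly (p i) t)"
      by metis
    have "\<forall>i. \<exists>q\<in>polys_over D. val_ge (int (Suc m)) (h (mfps_X i) - poly q t)"
      using X unfolding polynomial_limits_def by blast
    then obtain q where q: "\<And>i. q i \<in> polys_over D"
      "\<And>i. val_ge (int (Suc m)) (h (mfps_X i) - poly (q i) t)"
      by metis
    define r where "r = [:h (mfps_const (mfps_coeff f 0)):] + (\<Sum>i\<in>UNIV. p i * q i)"
    have "r \<in> polys_over D"
      unfolding r_def
      using p q const is_subringD(1)[OF P] by (intro is_subringD[OF P] is_subring_sum[OF P]) auto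
    \<comment> \<open>\<open>h (g i)\<close> is known only to order \<open>m\<close>; the missing
      order comes from the positive value of the variable.\<close>
    moreover have "val_ge (int (Suc m)) (h (g i) * h (mfps_X i) - poly (p i) t * poly (q i) t)" for i
      using val_ge_mult_diff[OF p(2) X_pos _ _ q(2)] poly_in_valuation_ring[OF p(1)]
      by (simp add: mem_valuation_ring)
    hence "val_ge (int (Suc m)) (\<Sum>i\<in>UNIV. h (g i) * h (mfps_X i) - poly (p i) t * poly (q i) t)"
      by (rule val_ge_sum)
    hence "val_ge (int (Suc m)) (h f - poly r t)"
      by (simp add: f r_def poly_sum sum_subtractf)
    ultimately show ?case by blast
  qed
  thus ?thesis by (simp add: polynomial_limits_def)
qed

end

end

section \<open>Reachable systems of variables\<close>

text \<open>Forgets the homomorphism and the exact coefficient field. Coefficient fields only grow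
  along a sequence, so bounding the last one by \<open>D\<close> bounds them all.\<close>

definition reachable ::
    "('l::field \<Rightarrow> int extended) \<Rightarrow> 'l set \<Rightarrow> 'l set \<Rightarrow> ('n::finite \<Rightarrow> 'l) \<Rightarrow> ('n \<Rightarrow> 'l) \<Rightarrow> bool" where
  "reachable w D F X Y \<longleftrightarrow> (\<exists>\<phi> G. transformation_sequence w F X \<phi> G Y \<and> G \<subseteq> D)"

lemma reachable_refl: "F \<subseteq> D \<Longrightarrow> reachable w D F X X"
  unfolding reachable_def using transformation_sequence.start by blast

lemma reachable_divide:
  assumes "reachable w D F X Y" "i \<noteq> j" "w (Y i) < w (Y j)"
  shows "reachable w D F X (Y(j := Y j / Y i))"
proof -
  obtain \<phi> G where G: "transformation_sequence w F X \<phi> G Y" "G \<subseteq> D"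
    using assms(1) unfolding reachable_def by blast
  have "monoidal_transformation w i j G Y (restrict (mfps_subst
      (\<lambda>l. if l = j then mfps_X i * mfps_X j else mfps_X l)) (mfps_over G)) G (Y(j := Y j / Y i))"
    unfolding monoidal_transformation_def using assms by (auto simp: fun_eq_iff)
  from transformation_sequence.monoidal[OF G(1) this] show ?thesis
    unfolding reachable_def using G(2) by blast
qed

lemma reachable_induct [consumes 1, case_names refl divide shift]:
  assumes "reachable w D F X Y"
    and refl: "P X"
    and divide: "\<And>Y i j. P Y \<Longrightarrow> i \<noteq> j \<Longrightarrow> w (Y i) < w (Y j) \<Longrightarrow> P (Y(j := Y j / Y i))"
    and shift: "\<And>Y i c. P Y \<Longrightarrow> (\<And>l. l \<noteq> i \<Longrightarrow> c l \<in> D) \<Longrightarrow>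
      P (\<lambda>l. if l = i then Y i else Y l - c l * Y i)"
  shows "P Y"
proof -
  obtain \<phi> G where "transformation_sequence w F X \<phi> G Y" "G \<subseteq> D"
    using assms(1) unfolding reachable_def by blast
  thus ?thesis
  proof (induction rule: transformation_sequence.induct)
    case (monoidal \<phi> G Y i j \<psi> H Z)
    hence Z: "Z = Y(j := Y j / Y i)" and "P Y" "i \<noteq> j" "w (Y i) < w (Y j)"
      by (auto simp: monoidal_transformation_def fun_eq_iff)
    show ?case
      unfolding Z by (rule divide) fact+
  next
    case (coordinates \<phi> G Y i c \<psi> H Z)
    hence Z: "Z = (\<lambda>l. if l = i then Y i else Y l - c l * Y i)"
      and "P Y" and c: "\<And>l. l \<noteq> i \<Longrightarrow> c l \<in> D"
      by (auto simp: coordinate_change_def)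
    show ?case
      unfolding Z using \<open>P Y\<close> c by (rule shift)
  qed (rule refl)
qed

context discretely_valued
begin

lemma reachable_shift_units:
  fixes X Y :: "'n::finite \<Rightarrow> 'l"
  assumes D: "is_subfield D" "D \<subseteq> valuation_ring w"
    and Y: "reachable w D F X Y" and c: "\<And>l. l \<noteq> i \<Longrightarrow> c l \<in> D \<and> c l \<noteq> 0"
  shows "reachable w D F X (\<lambda>l. if l = i then Y i else Y l - c l * Y i)"
proof -
  obtain \<phi> G where G: "transformation_sequence w F X \<phi> G Y" "G \<subseteq> D"
    using Y unfolding reachable_def by blast
  have "c l \<in> valuation_ring w - valuation_ideal w" if "l \<noteq> i" for l
    using subfield_unit[OF D] c[OF that] unit_iff by blast
  \<comment> \<open>The coefficient field is enlarged at once to all of \<open>D\<close>, whose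
    nonzero elements are units.\<close>
  hence "coordinate_change w i c G Y (restrict (mfps_subst
      (\<lambda>l. if l = i then mfps_X i else mfps_X l + mfps_const (c l) * mfps_X i)) (mfps_over G)) D
      (\<lambda>l. if l = i then Y i else Y l - c l * Y i)"
    unfolding coordinate_change_def using D G c by auto
  from transformation_sequence.coordinates[OF G(1) this] show ?thesis
    unfolding reachable_def by blast
qed

text \<open>
  A coordinate change only admits unit coefficients, so an arbitrary coefficient is written as
  a sum of two units.
\<close>

lemma reachable_shift:
  fixes X Y :: "'n::finite \<Rightarrow> 'l"
  assumes D: "is_subfield D" "D \<subseteq> valuation_ring w" and two: "(2 :: 'l) \<noteq> 0"
    and Y: "reachable w D F X Y" and d: "\<And>l. d l \<in> D"
  shows "reachable w D F X (\<lambda>l. if l = i then Y i else Y l - d l * Y i)"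
proof -
  note S = is_subringD[OF is_subfield_imp_subring[OF D(1)]]
  \<comment> \<open>The two units are \<open>c l\<close> and \<open>d l - c l\<close>. The latter
    vanishes for \<open>c l = 1\<close> only if \<open>d l = 1\<close>; there \<open>-1\<close> is
    used and the difference is \<open>2\<close>, nonzero by assumption.\<close>
  define c where "c l = (if d l = 1 then -1 else 1 :: 'l)" for l
  have c: "c l \<in> D" "c l \<noteq> 0" and d_c: "d l - c l \<in> D" "d l - c l \<noteq> 0" for l
    using d[of l] two S by (auto simp: c_def)
  let ?Y = "\<lambda>l. if l = i then Y i else Y l - c l * Y i"
  have "reachable w D F X ?Y"
    using c by (intro reachable_shift_units[OF D Y]) auto
  from reachable_shift_units[OF D this, where c = "\<lambda>l. d l - c l" and i = i] d_c
  have "reachable w D F X (\<lambda>l. if l = i then ?Y i else ?Y l - (d l - c l) * ?Y i)"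
    by blast
  moreover have "(\<lambda>l. if l = i then ?Y i else ?Y l - (d l - c l) * ?Y i)
      = (\<lambda>l. if l = i then Y i else Y l - d l * Y i)"
    by (auto simp: algebra_simps)
  ultimately show ?thesis by simp
qed

lemma reachable_divide_all:
  fixes X Y :: "'n::finite \<Rightarrow> 'l"
  assumes Y: "reachable w D F X Y" and less: "\<And>l. l \<noteq> i \<Longrightarrow> w (Y i) < w (Y l)"
  shows "reachable w D F X (\<lambda>l. if l = i then Y i else Y l / Y i)"
proof -
  \<comment> \<open>Variables are divided one at a time: the pivot \<open>Y i\<close> and the
    variables outside \<open>A\<close> are untouched, so the strict inequality is still available
    for the next one.\<close>
  have "reachable w D F X (\<lambda>l. if l \<in> A then Y l / Y i else Y l)" if "finite A" "i \<notin> A" for A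
    using that
  proof (induction A rule: finite_induct)
    case (insert j A)
    let ?Y = "\<lambda>l. if l \<in> A then Y l / Y i else Y l"
    have "reachable w D F X (?Y(j := ?Y j / ?Y i))"
      using insert less[of j] by (intro reachable_divide) auto
    moreover have "?Y(j := ?Y j / ?Y i) = (\<lambda>l. if l \<in> insert j A then Y l / Y i else Y l)"
      using insert by (auto simp: fun_eq_iff)
    ultimately show ?case by simp
  qed (use Y in simp)
  from this[of "- {i}"] have "reachable w D F X (\<lambda>l. if l \<in> - {i} then Y l / Y i else Y l)"
    by simp
  moreover have "(\<lambda>l. if l \<in> - {i} then Y l / Y i else Y l) = (\<lambda>l. if l = i then Y i else Y l / Y i)"
    by auto
  ultimately show ?thesis
    by (simp only:)
qed

section \<open>Properties carried along transformation sequences\<close>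

lemma reachable_positive:
  assumes D: "D \<subseteq> valuation_ring w" and "reachable w D F X Y" and X: "\<And>l. val_ge 1 (X l)"
  shows "val_ge 1 (Y l)"
  using assms(2)
proof (induction arbitrary: l rule: reachable_induct)
  case refl
  show ?case by (rule X)
next
  case (divide Y i j)
  show ?case
  \<comment> \<open>For finite values the strict inequality between integers leaves a quotient of
    value at least 1. If \<open>Y j = 0\<close>, the quotient is 0 and meets every bound.\<close>
  proof (cases "l = j \<and> Y j \<noteq> 0")
    case True
    then obtain m where m: "w (Y j) = Fin m" by (auto elim: val_finite)
    with divide val_0 have "Y i \<noteq> 0" by auto
    then obtain n where n: "w (Y i) = Fin n" by (rule val_finite)
    have "w (Y j / Y i) = Fin (m - n)" using m n by (rule val_divide)
    thus ?thesis using True divide m n by (simp add: val_ge_iff)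
  qed (use divide in auto)
next
  case (shift Y i c)
  have "val_ge (0 + 1) (c l * Y i)" if "l \<noteq> i"
    using shift(1) shift(2)[OF that] D by (intro val_ge_mult) (auto simp: mem_valuation_ring)
  thus ?case using shift by (auto intro: val_ge_diff)
qed

text \<open>The inverse transformations are polynomial: old variables are products of new ones, or
  sums of new ones with multiples by elements of \<open>D\<close>. Membership in a ring over
  \<open>D\<close> therefore passes back to the starting variables.\<close>

lemma reachable_subring:
  assumes "reachable w D F X Y" "is_subring S" "D \<subseteq> S" "range Y \<subseteq> S"
  shows "range X \<subseteq> S"
proof -
  note S = is_subringD[OF assms(2)]
  have "range Y \<subseteq> S \<longrightarrow> range X \<subseteq> S"
    using assms(1)
  proof (induction rule: reachable_induct)
    case (divide Y i j)
    have "Y i \<noteq> 0" using divide(3) val_0 by auto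
    hence Y: "Y l = (if l = j then (Y(j := Y j / Y i)) j * (Y(j := Y j / Y i)) i
        else (Y(j := Y j / Y i)) l)" for l
      using divide(2) by simp
    have "range Y \<subseteq> S" if "range (Y(j := Y j / Y i)) \<subseteq> S"
    proof -
      have "(Y(j := Y j / Y i)) l \<in> S" for l using that by blast
      hence "Y l \<in> S" for l by (subst Y) (auto intro!: S(4) simp del: fun_upd_apply)
      thus ?thesis by blast
    qed
    thus ?case using divide(1) by blast
  next
    case (shift Y i c)
    let ?Z = "\<lambda>l. if l = i then Y i else Y l - c l * Y i"
    have "range Y \<subseteq> S" if Z: "range ?Z \<subseteq> S"
    proof -
      have Z': "?Z l \<in> S" for l using Z by blast
      have Yi: "Y i \<in> S" using Z'[of i] by simp
      have "Y l \<in> S" if "l \<noteq> i" for l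
      proof -
        have "(Y l - c l * Y i) + c l * Y i \<in> S"
          using Z'[of l] Yi shift(2)[OF that] assms(3) that by (intro S(6,4)) auto
        thus ?thesis by simp
      qed
      hence "Y l \<in> S" for l using Yi by (cases "l = i") auto
      thus ?thesis by blast
    qed
    thus ?case using shift(1) by blast
  qed simp
  thus ?thesis using assms(4) by blast
qed

section \<open>Expansions in powers of a variable of least value\<close>

lemma reachable_expansion:
  fixes X Y :: "'n::finite \<Rightarrow> 'l"
  assumes D: "is_subfield D" "D \<subseteq> valuation_ring w" and two: "(2 :: 'l) \<noteq> 0"
    and coeff: "\<And>x. x \<in> valuation_ring w \<Longrightarrow> \<exists>d\<in>D. val_ge 1 (x - d)"
    and min: "\<And>Z l. reachable w D F X Z \<Longrightarrow> val_ge n (Z l)"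
    and Y: "reachable w D F X Y" "w (Y i) = Fin n"
  shows "\<exists>Z. reachable w D F X Z \<and> Z i = Y i \<and>
    (\<forall>l. l \<noteq> i \<longrightarrow> (\<exists>p\<in>polys_over D. Y l = poly p (Y i) + Y i ^ m * Z l))"
proof (induction m)
  case 0
  note P = is_subringD[OF is_subring_polys_over[OF is_subfield_imp_subring[OF D(1)]]]
  show ?case
    using Y(1) P(1) by (intro exI[of _ Y]) (auto intro!: bexI[of _ 0])
next
  case (Suc m)
  note P = is_subringD[OF is_subring_polys_over[OF is_subfield_imp_subring[OF D(1)]]]
  define t where "t = Y i"
  have t: "t \<noteq> 0" "w t = Fin n"
    using Y(2) val_nonzero by (auto simp: t_def)
  obtain Z where Z: "reachable w D F X Z" "Z i = t"
    and exp: "\<And>l. l \<noteq> i \<Longrightarrow> \<exists>p\<in>polys_over D. Y l = poly p t + t ^ m * Z l"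
    using Suc unfolding t_def by blast
  \<comment> \<open>Minimality applies to the reachable remainders \<open>Z\<close>, so
    \<open>Z l / t\<close> is integral and its residue has a representative in \<open>D\<close>: the
    next digit.\<close>
  have "\<exists>d\<in>D. val_ge 1 (Z l / t - d)" for l
    using coeff val_ge_divide[OF min[OF Z(1)] t(2)] by (simp add: mem_valuation_ring)
  then obtain d where d: "\<And>l. d l \<in> D" "\<And>l. val_ge 1 (Z l / t - d l)"
    by metis
  let ?Z = "\<lambda>l. if l = i then Z i else Z l - d l * Z i"
  have reach: "reachable w D F X ?Z"
    using D two Z(1) d(1) by (rule reachable_shift)
  have "w t < w (Z l - d l * t)" for l
  proof -
    have "val_ge (1 + n) ((Z l / t - d l) * t)"
      using d t by (intro val_ge_mult) (auto simp: val_ge_iff)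
    hence "val_ge (1 + n) (Z l - d l * t)"
      using t(1) by (simp add: left_diff_distrib)
    thus ?thesis
      unfolding t(2) val_ge_def by (rule less_le_trans[rotated]) simp
  qed
  hence "reachable w D F X (\<lambda>l. if l = i then ?Z i else ?Z l / ?Z i)"
    using reach by (intro reachable_divide_all) (auto simp: Z(2))
  hence "reachable w D F X (\<lambda>l. if l = i then t else (Z l - d l * t) / t)" (is "reachable _ _ _ _ ?V")
    by (simp add: Z(2) cong: if_cong)
  moreover have "\<exists>p\<in>polys_over D. Y l = poly p t + t ^ Suc m * ?V l" if l: "l \<noteq> i" for l
  proof -
    obtain p where p: "p \<in> polys_over D" "Y l = poly p t + t ^ m * Z l"
      using exp[OF l] by blast
    \<comment> \<open>Since \<open>Z l = d l * t + t * ?V l\<close>, the digit becomes the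
      coefficient of \<open>t ^ Suc m\<close> and the new remainder carries that same power.\<close>
    have "p + monom (d l) (Suc m) \<in> polys_over D"
      using p(1) d(1) by (intro P monom_in_polys_over is_subfield_imp_subring D)
    moreover have "Y l = poly (p + monom (d l) (Suc m)) t + t ^ Suc m * ?V l"
      using t(1) l by (simp add: p(2) poly_monom field_simps)
    ultimately show ?thesis by blast
  qed
  ultimately show ?case
    unfolding t_def[symmetric] by (intro exI[of _ ?V] conjI allI impI) simp_all
qed

lemma minimal_variables_in_polynomial_limits:
  fixes X Y :: "'n::finite \<Rightarrow> 'l"
  assumes D: "is_subfield D" "D \<subseteq> valuation_ring w" and two: "(2 :: 'l) \<noteq> 0"
    and coeff: "\<And>x. x \<in> valuation_ring w \<Longrightarrow> \<exists>d\<in>D. val_ge 1 (x - d)"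
    and min: "\<And>Z l. reachable w D F X Z \<Longrightarrow> val_ge n (Z l)"
    and Y: "reachable w D F X Y" "w (Y i) = Fin n" and "n \<ge> 1"
  shows "range Y \<subseteq> polynomial_limits D (Y i)"
proof -
  note P = is_subringD[OF is_subring_polys_over[OF is_subfield_imp_subring[OF D(1)]]]
  have t: "val_ge 1 (Y i)" using Y \<open>n \<ge> 1\<close> by (simp add: val_ge_iff)
  have expansion: "\<exists>Z. reachable w D F X Z \<and> Z i = Y i \<and>
    (\<forall>l. l \<noteq> i \<longrightarrow> (\<exists>p\<in>polys_over D. Y l = poly p (Y i) + Y i ^ m * Z l))" for m
    using D two coeff min Y by (rule reachable_expansion)
  have "Y l \<in> polynomial_limits D (Y i)" for l
  proof (cases "l = i")
    case True
    have "[:0, 1:] \<in> polys_over D"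
      using P D by (auto simp: is_subfield_def)
    from poly_in_polynomial_limits[OF D t this] show ?thesis using True by simp
  next
    case False
    have "\<exists>p\<in>polys_over D. val_ge (int m) (Y l - poly p (Y i))" for m
    proof -
      obtain Z p where Z: "reachable w D F X Z" "p \<in> polys_over D"
        "Y l = poly p (Y i) + Y i ^ m * Z l"
        using expansion[of m] False by metis
      \<comment> \<open>The remainder tends to zero: \<open>m\<close> factors of positive value
        times an integral element.\<close>
      have "val_ge (int m + n) (Y i ^ m * Z l)"
        by (intro val_ge_mult val_ge_power t min Z)
      thus ?thesis using Z \<open>n \<ge> 1\<close> by (intro bexI[of _ p]) (auto elim: val_ge_mono)
    qed
    thus ?thesis by (simp add: polynomial_limits_def)
  qed
  thus ?thesis by blast
qed

end

section \<open>Divisibility of all values by the least reachable value\<close>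

theorem theorem2:
  fixes v :: "('k::{alg_closed_field, field_char_0}, 'n::finite) psfield \<Rightarrow> int extended"
    and w :: "'l::field \<Rightarrow> int extended"
    and \<iota> :: "('k, 'n) psfield \<Rightarrow> 'l"
  assumes "discrete_valuation v"
    and "trivial_on_constants v"
    and "has_center v mfps_X_ideal"
    and "is_completion v w \<iota>"
  shows "\<exists>\<phi> G Y. transformation_sequence w
           (range (\<lambda>c. \<iota> (psfield_const c))) (\<lambda>i. \<iota> (to_fract (mfps_X i))) \<phi> G Y \<and>
         (\<exists>i. w (Y i) = Fin 1)"
proof -
  interpret v: discretely_valued v
    by unfold_locales (rule assms(1))
  interpret complete_discretely_valued w
    using assms(4) by unfold_locales (auto simp: is_completion_def)
  have \<iota>: "field_embedding \<iota>" and w_\<iota>: "w (\<iota> x) = v x" for x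
    using assms(4) by (auto simp: is_completion_def)
  define F where "F = range (\<lambda>c. \<iota> (psfield_const c :: ('k, 'n) psfield))"
  define h where "h f = \<iota> (to_fract (f :: ('k, 'n) mfps))" for f
  define X where "X i = h (mfps_X i)" for i
  have e: "field_embedding (\<lambda>c. \<iota> (psfield_const c :: ('k, 'n) psfield))"
    by (rule field_embedding_comp[OF field_embedding_psfield_const \<iota>])
  have w_const: "w (\<iota> (psfield_const c)) = Fin 0" if "c \<noteq> 0" for c
    using assms(2) that by (simp add: trivial_on_constants_def w_\<iota>)
  \<comment> \<open>Nonzero constants have value 0, so they stay nonzero in the completion and
    characteristic zero is inherited from \<open>'k\<close>.\<close>
  have char0: "of_nat n \<noteq> (0 :: 'l)" if "n > 0" for n
    using w_const[of "of_nat n"] that val_nonzero unfolding field_embedding_of_nat[OF e] by auto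
  have two: "(2 :: 'l) \<noteq> 0"
    using char0[of 2] by simp
  have F: "is_subfield F" "F \<subseteq> valuation_ring w"
  proof -
    show "is_subfield F"
      unfolding F_def using e by (rule is_subfield_range)
    have "val_ge 0 (\<iota> (psfield_const c))" for c
      using w_const[of c] field_embedding_0[OF e] by (cases "c = 0") (auto simp: val_ge_iff)
    thus "F \<subseteq> valuation_ring w"
      by (auto simp: F_def mem_valuation_ring)
  qed
  obtain D where D: "is_subfield D" "F \<subseteq> D" "D \<subseteq> valuation_ring w"
    and coeff: "\<And>x. x \<in> valuation_ring w \<Longrightarrow> \<exists>d\<in>D. val_ge 1 (x - d)"
    using coefficient_field_exists[OF F char0] by blast
  have h_add: "h (f + g) = h f + h g" and h_mult: "h (f * g) = h f * h g" for f g
    using \<iota> by (auto simp: h_def field_embedding_def)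
  have h_const: "h (mfps_const c) \<in> D" for c
    using D(2) by (auto simp: F_def h_def psfield_const_def)
  have h_integral: "h f \<in> valuation_ring w" for f
    using assms(3) by (auto simp: has_center_def h_def valuation_ring_def w_\<iota>)
  have "to_fract (mfps_X i) \<in> valuation_ideal v" for i
    using assms(3) mfps_X_in_ideal unfolding has_center_def by blast
  hence X_pos: "val_ge 1 (X i)" for i
    unfolding mem_valuation_ideal[symmetric] by (simp add: valuation_ideal_def X_def h_def w_\<iota>)
  have h_nonzero: "h f \<noteq> 0" if "f \<noteq> 0" for f
  proof -
    have "v (to_fract f) \<noteq> \<infinity>" using that v.val_eq_infinity_iff by simp
    thus ?thesis using w_\<iota>[of "to_fract f"] val_0 unfolding h_def by metis
  qed

  \<comment> \<open>Reachable values are positive, so they can be indexed by naturals and have a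
    least one. Only finite values count, since variables may become 0.\<close>
  define Q where "Q n \<longleftrightarrow> (\<exists>Y l. reachable w D F X Y \<and> w (Y l) = Fin (int n))" for n
  define n where "n = (LEAST n. Q n)"
  have positive: "val_ge 1 (Y l)" if "reachable w D F X Y" for Y l
    by (rule reachable_positive[OF D(3) that X_pos])
  have Q: "Q (nat m)" if "reachable w D F X Y" "w (Y l) = Fin m" for Y l m
  proof -
    have "1 \<le> m" using positive[OF that(1), of l] val_ge_iff[OF that(2)] by simp
    thus ?thesis using that by (auto simp: Q_def)
  qed
  \<comment> \<open>Any index serves: every initial variable is nonzero, so some finite value is
    reachable.\<close>
  obtain m where "w (X undefined) = Fin m"
    unfolding X_def using h_nonzero mfps_X_nonzero val_finite by metis
  hence "Q (nat m)"
    by (rule Q[OF reachable_refl[OF D(2)]])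
  hence "Q n"
    unfolding n_def by (rule LeastI)
  then obtain Y i where Y: "reachable w D F X Y" "w (Y i) = Fin (int n)"
    by (auto simp: Q_def)
  have n: "int n \<ge> 1"
    using positive[OF Y(1), of i] val_ge_iff[OF Y(2)] by simp
  have min: "val_ge (int n) (Z l)" if "reachable w D F X Z" for Z l
  proof (cases "Z l = 0")
    case False
    then obtain m where m: "w (Z l) = Fin m" by (rule val_finite)
    have "n \<le> nat m" unfolding n_def by (rule Least_le) (rule Q[OF that m])
    moreover have "1 \<le> m" using positive[OF that, of l] val_ge_iff[OF m] by simp
    ultimately show ?thesis using m by (simp add: val_ge_iff)
  qed simp

  have t: "val_ge 1 (Y i)" using positive[OF Y(1)] .
  note limits = is_subring_polynomial_limits[OF D(1,3) t]
    subfield_subset_polynomial_limits[OF D(1,3) t]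
  have "range Y \<subseteq> polynomial_limits D (Y i)"
    using D(1,3) two coeff min Y n by (rule minimal_variables_in_polynomial_limits)
  hence "range X \<subseteq> polynomial_limits D (Y i)"
    by (rule reachable_subring[OF Y(1) limits])
  hence "h (mfps_X l) \<in> polynomial_limits D (Y i)" for l
    by (auto simp: X_def)
  with D(1,3) t h_add h_mult h_const h_integral X_pos[unfolded X_def]
  have h_limit: "h f \<in> polynomial_limits D (Y i)" for f
    by (rule power_series_in_polynomial_limits)
  have dvd: "\<exists>k. w (h f) = Fin k \<and> int n dvd k" if "f \<noteq> 0" for f
    by (rule val_polynomial_limits_dvd[OF D(1,3) t Y(2) h_limit h_nonzero[OF that]])

  \<comment> \<open>The value group is all of the integers. Writing an element of value 1 as a
    fraction of power series makes 1 a difference of two multiples of \<open>n\<close>.\<close>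
  have "Fin 1 \<in> v ` (- {0})"
    using assms(1) by (simp add: discrete_valuation_def)
  then obtain x where x: "v x = Fin 1" by (elim imageE) simp
  obtain a b where ab: "x = Fract a b" "b \<noteq> 0" by (rule Fract_cases)
  hence "x * to_fract b = to_fract a"
    by (simp add: Fract_conv_to_fract)
  from this[symmetric] have hx: "h a = \<iota> x * h b"
    using \<iota> unfolding h_def field_embedding_def by simp
  obtain k where k: "w (h b) = Fin k" "int n dvd k" using dvd[OF ab(2)] by blast
  have wa: "w (h a) = Fin (1 + k)"
    unfolding hx val_mult w_\<iota> x k(1) by simp
  hence a: "a \<noteq> 0"
    using val_nonzero[OF wa] field_embedding_0[OF \<iota>] by (auto simp: h_def)
  obtain k' where "w (h a) = Fin k'" "int n dvd k'" using dvd[OF a] by blast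
  hence "int n dvd 1 + k"
    unfolding wa extended.inject by (simp only:)
  hence "int n dvd (1 + k) - k"
    using k(2) by (rule dvd_diff)
  hence "w (Y i) = Fin 1"
    using Y(2) by simp
  moreover obtain \<phi> G where "transformation_sequence w F X \<phi> G Y"
    using Y(1) by (auto simp: reachable_def)
  ultimately show ?thesis
    unfolding F_def X_def h_def by (intro exI conjI)
qed

end
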